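(* Let $f,g:(a,b)\to\mathbb{R}$ be smooth functions with $f$ nowhere zero and either $f'^2-g'^2=1$ on $(a,b)$ or $f'^2-g'^2=-1$ on $(a,b)$, and let $M^2$ be the surface of revolution in $E_1^3$ (with timelike axis) parametrized by $$\boldsymbol{x}(s,\theta)=\big(f(s)\cos\theta,\; f(s)\sin\theta,\; g(s)\big),\qquad s\in(a,b),\ \theta\in\mathbb{R}.$$ Assume that $M^2$ is non-degenerate with nowhere vanishing Gauss curvature. Then there exists a real $3\times 3$ matrix $A$ with $\Delta^{III}\boldsymbol{x}=A\boldsymbol{x}$ on $M^2$ if and only if one of the following holds: (i) $M^2$ is (an open part of) a pseudosphere of real or imaginary radius, i.e. of $S^2_1(c)$ or of $H^2(c)$, for some $c>0$; (ii) $M^2$ has zero mean curvature (identically).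
   Context: $E_1^3$ is $\mathbb{R}^3$ with coordinates $(x,y,z)$ and the Lorentzian metric $\langle\cdot,\cdot\rangle=dx^2+dy^2-dz^2$. For a parametrized surface $\boldsymbol{x}(s,\theta)$ in $E_1^3$, put $E=\langle \boldsymbol{x}_s,\boldsymbol{x}_s\rangle$, $F=\langle \boldsymbol{x}_s,\boldsymbol{x}_\theta\rangle$, $G=\langle \boldsymbol{x}_\theta,\boldsymbol{x}_\theta\rangle$. The surface is non-degenerate if $EG-F^2\neq 0$ everywhere; then $\boldsymbol{n}$ denotes a unit normal field ($\langle\boldsymbol{n},\boldsymbol{n}\rangle=\pm1$), and the second fundamental form has coefficients $L=\langle \boldsymbol{x}_{ss},\boldsymbol{n}\rangle$, $M=\langle \boldsymbol{x}_{s\theta},\boldsymbol{n}\rangle$, $N=\langle \boldsymbol{x}_{\theta\theta},\boldsymbol{n}\rangle$. Nowhere vanishing Gauss curvature means $LN-M^2\neq0$ everywhere (no parabolic points). Zero mean curvature means $EN-2FM+GL=0$ identically. The third fundamental form $III$ has coefficients $e_{11}=\langle\boldsymbol{n}_s,\boldsymbol{n}_s\rangle$, $e_{12}=e_{21}=\langle\boldsymbol{n}_s,\boldsymbol{n}_\theta\rangle$, $e_{22}=\langle\boldsymbol{n}_\theta,\boldsymbol{n}_\theta\rangle$; it is non-degenerate when $LN-M^2\ne0$. With $e=\det(e_{km})$, $(e^{km})$ the inverse matrix of $(e_{km})$ and $(u^1,u^2)=(s,\theta)$, the Laplace operator with respect to $III$ is $$\Delta^{III}p=-\frac{1}{\sqrt{|e|}}\sum_{k,m}\frac{\partial}{\partial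 u^m}\Big(\sqrt{|e|}\,e^{km}\frac{\partial p}{\partial u^k}\Big)$$ for smooth functions $p$, and $\Delta^{III}\boldsymbol{x}$ is defined componentwise. $S_1^2(c)=\{x^2+y^2-z^2=c^2\}$ is the pseudosphere of real radius $c$, and $H^2(c)=\{x^2+y^2-z^2=-c^2\}$ is the pseudosphere of imaginary radius. *)

theory Defs
  imports "HOL-Analysis.Analysis"
begin

definition smooth_on :: "real set \<Rightarrow> (real \<Rightarrow> real) \<Rightarrow> bool" where
  "smooth_on S f \<longleftrightarrow> (\<forall>k. \<forall>s\<in>S. ((deriv ^^ k) f) differentiable (at s))"

definition lorentz :: "real^3 \<Rightarrow> real^3 \<Rightarrow> real" where
  "lorentz v w = v $ 1 * w $ 1 + v $ 2 * w $ 2 - v $ 3 * w $ 3"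

text \<open>Parameter points are \<open>u = (s, \<theta>)\<close>, so \<open>u $ 1\<close> is \<open>s\<close> and \<open>u $ 2\<close> is \<open>\<theta>\<close>;
  \<open>pdv p k u\<close> is the partial derivative of \<open>p\<close> at \<open>u\<close> in the \<open>k\<close>-th coordinate, and
  iterated subscripts such as \<open>x\<^sub>s\<^sub>\<theta>\<close> read \<open>pdv (pdv x 1) 2\<close>.\<close>

definition pdv :: "(real^2 \<Rightarrow> 'a::real_normed_vector) \<Rightarrow> 2 \<Rightarrow> real^2 \<Rightarrow> 'a" where
  "pdv p k u = vector_derivative (\<lambda>t. p (u + t *\<^sub>R axis k 1)) (at 0)"

definition ff_E :: "(real^2 \<Rightarrow> real^3) \<Rightarrow> real^2 \<Rightarrow> real" where
  "ff_E x u = lorentz (pdv x 1 u) (pdv x 1 u)"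

definition ff_F :: "(real^2 \<Rightarrow> real^3) \<Rightarrow> real^2 \<Rightarrow> real" where
  "ff_F x u = lorentz (pdv x 1 u) (pdv x 2 u)"

definition ff_G :: "(real^2 \<Rightarrow> real^3) \<Rightarrow> real^2 \<Rightarrow> real" where
  "ff_G x u = lorentz (pdv x 2 u) (pdv x 2 u)"

definition nondegenerate_on :: "(real^2) set \<Rightarrow> (real^2 \<Rightarrow> real^3) \<Rightarrow> bool" where
  "nondegenerate_on D x \<longleftrightarrow> (\<forall>u\<in>D. ff_E x u * ff_G x u - (ff_F x u)\<^sup>2 \<noteq> 0)"

text \<open>A continuous unit normal field of a smooth non-degenerate surface is automatically smooth,
  since locally it is unique up to sign.\<close>

definition unit_normal_field_on ::
  "(real^2) set \<Rightarrow> (real^2 \<Rightarrow> real^3) \<Rightarrow> (real^2 \<Rightarrow> real^3) \<Rightarrow> bool" where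
  "unit_normal_field_on D x n \<longleftrightarrow>
     continuous_on D n \<and>
     (\<forall>u\<in>D. lorentz (n u) (pdv x 1 u) = 0 \<and> lorentz (n u) (pdv x 2 u) = 0 \<and>
            (lorentz (n u) (n u) = 1 \<or> lorentz (n u) (n u) = -1))"

definition sf_L :: "(real^2 \<Rightarrow> real^3) \<Rightarrow> (real^2 \<Rightarrow> real^3) \<Rightarrow> real^2 \<Rightarrow> real" where
  "sf_L x n u = lorentz (pdv (pdv x 1) 1 u) (n u)"

definition sf_M :: "(real^2 \<Rightarrow> real^3) \<Rightarrow> (real^2 \<Rightarrow> real^3) \<Rightarrow> real^2 \<Rightarrow> real" where
  "sf_M x n u = lorentz (pdv (pdv x 1) 2 u) (n u)"

definition sf_N :: "(real^2 \<Rightarrow> real^3) \<Rightarrow> (real^2 \<Rightarrow> real^3) \<Rightarrow> real^2 \<Rightarrow> real" where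
  "sf_N x n u = lorentz (pdv (pdv x 2) 2 u) (n u)"

definition gauss_curvature_nonvanishing_on ::
  "(real^2) set \<Rightarrow> (real^2 \<Rightarrow> real^3) \<Rightarrow> (real^2 \<Rightarrow> real^3) \<Rightarrow> bool" where
  "gauss_curvature_nonvanishing_on D x n \<longleftrightarrow>
     (\<forall>u\<in>D. sf_L x n u * sf_N x n u - (sf_M x n u)\<^sup>2 \<noteq> 0)"

definition zero_mean_curvature_on ::
  "(real^2) set \<Rightarrow> (real^2 \<Rightarrow> real^3) \<Rightarrow> (real^2 \<Rightarrow> real^3) \<Rightarrow> bool" where
  "zero_mean_curvature_on D x n \<longleftrightarrow>
     (\<forall>u\<in>D. ff_E x u * sf_N x n u - 2 * ff_F x u * sf_M x n u + ff_G x u * sf_L x n u = 0)"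

definition third_form :: "(real^2 \<Rightarrow> real^3) \<Rightarrow> real^2 \<Rightarrow> real^2^2" where
  "third_form n u = (\<chi> k m. lorentz (pdv n k u) (pdv n m u))"

definition laplace_III :: "(real^2 \<Rightarrow> real^3) \<Rightarrow> (real^2 \<Rightarrow> real) \<Rightarrow> real^2 \<Rightarrow> real" where
  "laplace_III n p u =
     - (1 / sqrt \<bar>det (third_form n u)\<bar>) *
       (\<Sum>k\<in>UNIV. \<Sum>m\<in>UNIV.
          pdv (\<lambda>v. sqrt \<bar>det (third_form n v)\<bar> * matrix_inv (third_form n v) $ k $ m * pdv p k v) m u)"

definition laplace_III_vec ::
  "(real^2 \<Rightarrow> real^3) \<Rightarrow> (real^2 \<Rightarrow> real^3) \<Rightarrow> real^2 \<Rightarrow> real^3" where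
  "laplace_III_vec n x u = (\<chi> i. laplace_III n (\<lambda>v. x v $ i) u)"

definition surf_rev :: "(real \<Rightarrow> real) \<Rightarrow> (real \<Rightarrow> real) \<Rightarrow> real^2 \<Rightarrow> real^3" where
  "surf_rev f g u = vector [f (u $ 1) * cos (u $ 2), f (u $ 1) * sin (u $ 2), g (u $ 1)]"

definition param_strip :: "real \<Rightarrow> real \<Rightarrow> (real^2) set" where
  "param_strip a b = {u. a < u $ 1 \<and> u $ 1 < b}"

definition pseudosphere_real :: "real \<Rightarrow> (real^3) set" where
  "pseudosphere_real c = {v. (v $ 1)\<^sup>2 + (v $ 2)\<^sup>2 - (v $ 3)\<^sup>2 = c\<^sup>2}"

definition pseudosphere_imaginary :: "real \<Rightarrow> (real^3) set" where
  "pseudosphere_imaginary c = {v. (v $ 1)\<^sup>2 + (v $ 2)\<^sup>2 - (v $ 3)\<^sup>2 = - (c\<^sup>2)}"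

definition open_part_of :: "(real^3) set \<Rightarrow> (real^3) set \<Rightarrow> bool" where
  "open_part_of M S \<longleftrightarrow> openin (top_of_set S) M"

end

theory Submission
  imports Defs "HOL-Computational_Algebra.Polynomial"
begin

text \<open>Write \<open>\<epsilon> = f'\<^sup>2 - g'\<^sup>2\<close> and \<open>(f'', g'') = \<kappa> (g', f')\<close>. The unit normal is
  \<open>\<plusminus>(g' cos \<theta>, g' sin \<theta>, f')\<close>, with a constant sign on which nothing depends
  (\<open>unit_normal_rotational\<close>). Absence of parabolic points means that \<open>\<kappa>\<close> and \<open>g'\<close> have no zeros. The third
  form is diagonal with entries \<open>\<epsilon> \<kappa>\<^sup>2\<close> and \<open>g'\<^sup>2\<close>, so the Laplacian of the position vector has the
  form \<open>(P cos \<theta>, P sin \<theta>, Q)\<close> with functions \<open>P\<close> and \<open>Q\<close> of \<open>s\<close>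
  (\<open>laplace_III_surf_rev\<close>). It is therefore a linear image of the position vector if and only if
  \<open>P = \<alpha> f\<close> and \<open>Q = \<beta> g\<close> for constants \<open>\<alpha>\<close>, \<open>\<beta>\<close> (\<open>linear_iff_eigenprofile\<close>).

  The geometric key is the sum \<open>W = 1 / \<kappa> + f / g'\<close> of the principal radii of curvature. The
  Lorentzian products of the Laplacian with the normal \<open>(g' cos \<theta>, g' sin \<theta>, f')\<close> and with
  \<open>x\<^sub>s\<close> are \<open>W\<close> and \<open>- W' / \<kappa>\<close> (\<open>normal_component\<close>, \<open>tangential_component\<close>). Zero mean
  curvature means \<open>W = 0\<close>, and then the Laplacian vanishes. On a pseudosphere centred at the origin the
  normal is a constant multiple of the position vector, \<open>W\<close> is constant and the Laplacian is
  \<open>- 2 \<epsilon>\<close> times the position vector.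

  Conversely, let \<open>P = \<alpha> f\<close> and \<open>Q = \<beta> g\<close>. Differentiating the first product and comparing with
  the second yields \<open>2 W' = (\<alpha> - \<beta>) f' g'\<close>. If \<open>\<alpha> = \<beta>\<close>, then \<open>W\<close> is constant, and either
  \<open>W = 0\<close> or \<open>f\<^sup>2 - g\<^sup>2\<close> is a nonzero constant (\<open>equal_eigenvalues_cases\<close>). If \<open>\<alpha> \<noteq> \<beta>\<close>, the
  equations give a relation, linear in \<open>f\<close> and \<open>g\<close>, with coefficients polynomial in \<open>f'\<close> and \<open>g'\<close>
  (\<open>algebraic_relation\<close>). Its derivative is another such relation, and the two force a polynomial in
  \<open>f'\<close> to vanish along the curve (\<open>polynomial_identity\<close>). Since \<open>f'\<close> takes infinitely many
  values, all its coefficients vanish, which is impossible (\<open>eigenvalues_equal\<close>).\<close>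

section \<open>Functions with a derivative on an interval\<close>

lemma inj_on_if_deriv_nonzero:
  fixes f :: "real \<Rightarrow> real"
  assumes "\<And>s. s \<in> {a<..<b} \<Longrightarrow> (f has_real_derivative f' s) (at s)"
    and "\<And>s. s \<in> {a<..<b} \<Longrightarrow> f' s \<noteq> 0"
  shows "inj_on f {a<..<b}"
proof (rule linorder_inj_onI)
  fix x y assume xy: "x < y" "x \<in> {a<..<b}" "y \<in> {a<..<b}"
  have "\<And>z. x \<le> z \<Longrightarrow> z \<le> y \<Longrightarrow> (f has_real_derivative f' z) (at z)"
    using xy assms(1) by auto
  from MVT2[OF xy(1) this] obtain z where z: "x < z" "z < y" "f y - f x = (y - x) * f' z"
    by blast
  then show "f x \<noteq> f y" using xy assms(2)[of z] by auto
qed auto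

lemma deriv_eq_if_eq_on_interval:
  fixes p q :: "real \<Rightarrow> real"
  assumes "\<And>r. r \<in> {a<..<b} \<Longrightarrow> p r = q r" "s \<in> {a<..<b}"
    and "(p has_real_derivative p') (at s)" "(q has_real_derivative q') (at s)"
  shows "p' = q'"
proof -
  have "(q has_real_derivative p') (at s)"
    by (rule has_field_derivative_transform_within_open[OF assms(3), of "{a<..<b}"])
       (use assms in auto)
  then show ?thesis using assms(4) DERIV_unique by blast
qed

lemma continuous_on_if_deriv:
  fixes p :: "real \<Rightarrow> real"
  assumes "\<And>s. s \<in> A \<Longrightarrow> (p has_real_derivative p' s) (at s)"
  shows "continuous_on A p"
  by (intro continuous_at_imp_continuous_on ballI DERIV_isCont[OF assms])

section \<open>Profile curves and the sum of the principal radii\<close>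

text \<open>Since \<open>(f', g')\<close> runs on a hyperbola, \<open>(f'', g'')\<close> is proportional to
  \<open>(g', f')\<close>; the factor \<open>\<kappa>\<close> is the signed Lorentzian curvature of the profile curve, that
  is, the speed of its hyperbolic angle.\<close>

locale unit_speed_profile =
  fixes a b \<epsilon> :: real and f g f' g' \<kappa> \<kappa>' :: "real \<Rightarrow> real"
  assumes ab: "a < b"
    and eps: "\<epsilon> = 1 \<or> \<epsilon> = -1"
    and deriv_f: "s \<in> {a<..<b} \<Longrightarrow> (f has_real_derivative f' s) (at s)"
    and deriv_g: "s \<in> {a<..<b} \<Longrightarrow> (g has_real_derivative g' s) (at s)"
    and deriv_f': "s \<in> {a<..<b} \<Longrightarrow> (f' has_real_derivative \<kappa> s * g' s) (at s)"
    and deriv_g': "s \<in> {a<..<b} \<Longrightarrow> (g' has_real_derivative \<kappa> s * f' s) (at s)"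
    and deriv_\<kappa>: "s \<in> {a<..<b} \<Longrightarrow> (\<kappa> has_real_derivative \<kappa>' s) (at s)"
    and unit: "s \<in> {a<..<b} \<Longrightarrow> (f' s)\<^sup>2 - (g' s)\<^sup>2 = \<epsilon>"
    and f_nz: "s \<in> {a<..<b} \<Longrightarrow> f s \<noteq> 0"
begin

lemma eps_sq: "\<epsilon> * \<epsilon> = 1" and eps_nz: "\<epsilon> \<noteq> 0"
  using eps by auto

end

text \<open>Up to sign, the Gauss curvature of the surface is \<open>\<kappa> g' / f\<close>, so these are the profiles of the surfaces without parabolic points.\<close>

locale profile = unit_speed_profile +
  assumes g'_nz: "s \<in> {a<..<b} \<Longrightarrow> g' s \<noteq> 0"
    and \<kappa>_nz: "s \<in> {a<..<b} \<Longrightarrow> \<kappa> s \<noteq> 0"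
begin

lemma inj_g: "inj_on g {a<..<b}"
  by (rule inj_on_if_deriv_nonzero[OF deriv_g g'_nz])

text \<open>This makes \<open>f'\<close> usable as a variable: a relation in \<open>f'\<close> that holds along the curve
  holds at infinitely many values.\<close>

lemma inj_f': "inj_on f' {a<..<b}"
  by (rule inj_on_if_deriv_nonzero[OF deriv_f']) (use g'_nz \<kappa>_nz in auto)

text \<open>The vector \<open>(radial cos \<theta>, radial sin \<theta>, axial)\<close> will turn out to be the Laplacian of
  the position vector; see \<open>laplace_III_surf_rev\<close>.\<close>

definition radial :: "real \<Rightarrow> real" where
  "radial s = - \<epsilon> * ((f' s)\<^sup>2 + (g' s)\<^sup>2) / (\<kappa> s * g' s) + \<epsilon> * f' s * \<kappa>' s / \<kappa> s ^ 3 + f s / (g' s)\<^sup>2"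

definition axial :: "real \<Rightarrow> real" where
  "axial s = - \<epsilon> * (2 * f' s / \<kappa> s - g' s * \<kappa>' s / \<kappa> s ^ 3)"

text \<open>The normal \<open>n = (g' cos \<theta>, g' sin \<theta>, f')\<close> satisfies \<open>n\<^sub>s = \<kappa> x\<^sub>s\<close> and
  \<open>n\<^sub>\<theta> = (g' / f) x\<^sub>\<theta>\<close>, so the two terms are the principal radii of curvature. Their sum vanishes
  exactly when the mean curvature does.\<close>

definition radii_sum :: "real \<Rightarrow> real" where
  "radii_sum s = 1 / \<kappa> s + f s / g' s"

definition radii_sum' :: "real \<Rightarrow> real" where
  "radii_sum' s = - \<kappa>' s / (\<kappa> s)\<^sup>2 + f' s / g' s - f s * \<kappa> s * f' s / (g' s)\<^sup>2"

lemma deriv_radii_sum: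
  assumes s: "s \<in> {a<..<b}"
  shows "(radii_sum has_real_derivative radii_sum' s) (at s)"
  unfolding radii_sum_def[abs_def]
  by (rule derivative_eq_intros deriv_f deriv_g' deriv_\<kappa> s g'_nz \<kappa>_nz refl)+
     (use g'_nz[OF s] \<kappa>_nz[OF s] in \<open>simp add: radii_sum'_def field_simps power2_eq_square\<close>)

text \<open>With \<open>W\<close> the sum of the radii and \<open>n = (g' cos \<theta>, g' sin \<theta>, f')\<close>, the next two lemmas say
  that the vector \<open>(radial cos \<theta>, radial sin \<theta>, axial)\<close> is \<open>- \<epsilon> (W n + (W' / \<kappa>) x\<^sub>s)\<close>: its Lorentzian
  products with \<open>n\<close> and \<open>x\<^sub>s\<close> are \<open>W\<close> and \<open>- W' / \<kappa>\<close>. So the single function \<open>W\<close> controls the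
  Laplacian; the term with \<open>W'\<close> is, up to sign, its gradient with respect to the third form.\<close>

lemma normal_component:
  assumes s: "s \<in> {a<..<b}"
  shows "g' s * radial s - f' s * axial s = radii_sum s"
proof -
  have "g' s * radial s - f' s * axial s
      = \<epsilon> * ((f' s)\<^sup>2 - (g' s)\<^sup>2) / \<kappa> s + f s / g' s"
    using g'_nz[OF s] \<kappa>_nz[OF s]
    by (simp add: radial_def axial_def field_simps power2_eq_square power3_eq_cube)
  then show ?thesis using eps_sq by (simp add: unit[OF s] radii_sum_def)
qed

lemma tangential_component:
  assumes s: "s \<in> {a<..<b}"
  shows "f' s * radial s - g' s * axial s = - radii_sum' s / \<kappa> s"
proof -
  have "f' s * radial s - g' s * axial s
      = - \<epsilon> * ((f' s)\<^sup>2 - (g' s)\<^sup>2) * f' s / (\<kappa> s * g' s)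
        + \<epsilon> * ((f' s)\<^sup>2 - (g' s)\<^sup>2) * \<kappa>' s / \<kappa> s ^ 3 + f s * f' s / (g' s)\<^sup>2"
    using g'_nz[OF s] \<kappa>_nz[OF s]
    by (simp add: radial_def axial_def field_simps power2_eq_square power3_eq_cube)
  also have "\<dots> = - f' s / (\<kappa> s * g' s) + \<kappa>' s / \<kappa> s ^ 3 + f s * f' s / (g' s)\<^sup>2"
    unfolding unit[OF s] using eps by auto
  also have "\<dots> = - radii_sum' s / \<kappa> s" using g'_nz[OF s] \<kappa>_nz[OF s]
    by (simp add: radii_sum'_def field_simps power2_eq_square power3_eq_cube)
  finally show ?thesis .
qed

lemma radial_axial_from_components:
  assumes s: "s \<in> {a<..<b}"
  shows "radial s = - \<epsilon> * (g' s * radii_sum s + f' s * radii_sum' s / \<kappa> s)"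
    and "axial s = - \<epsilon> * (f' s * radii_sum s + g' s * radii_sum' s / \<kappa> s)"
proof -
  note n = normal_component[OF s]
  have t: "radii_sum' s / \<kappa> s = g' s * axial s - f' s * radial s"
    using tangential_component[OF s] by simp
  have R: "g' s * radii_sum s + f' s * radii_sum' s / \<kappa> s = - ((f' s)\<^sup>2 - (g' s)\<^sup>2) * radial s"
    and A: "f' s * radii_sum s + g' s * radii_sum' s / \<kappa> s = - ((f' s)\<^sup>2 - (g' s)\<^sup>2) * axial s"
    unfolding n[symmetric] times_divide_eq_right[symmetric] t
    by (simp_all add: algebra_simps power2_eq_square)
  show "radial s = - \<epsilon> * (g' s * radii_sum s + f' s * radii_sum' s / \<kappa> s)"
    unfolding R unit[OF s] using eps_sq by (simp add: algebra_simps)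
  show "axial s = - \<epsilon> * (f' s * radii_sum s + g' s * radii_sum' s / \<kappa> s)"
    unfolding A unit[OF s] using eps_sq by (simp add: algebra_simps)
qed

lemma minimal_imp_harmonic:
  assumes "\<And>s. s \<in> {a<..<b} \<Longrightarrow> radii_sum s = 0" "s \<in> {a<..<b}"
  shows "radial s = 0" "axial s = 0"
proof -
  have "radii_sum' s = 0"
    by (rule deriv_eq_if_eq_on_interval[of a b radii_sum "\<lambda>_. 0", OF _ assms(2) deriv_radii_sum])
       (use assms in auto)
  then show "radial s = 0" "axial s = 0"
    using radial_axial_from_components[OF assms(2)] assms by auto
qed

text \<open>Differentiating \<open>f\<^sup>2 - g\<^sup>2 = k\<close> twice shows that both principal radii are equal to
  \<open>1 / \<kappa>\<close> and constant: the normal of a pseudosphere is a constant multiple of its position vector.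
  The gradient part of the Laplacian then vanishes.\<close>

lemma hyperbola_imp_eigen:
  assumes k: "\<And>s. s \<in> {a<..<b} \<Longrightarrow> (f s)\<^sup>2 - (g s)\<^sup>2 = k" and s: "s \<in> {a<..<b}"
  shows "radial s = - 2 * \<epsilon> * f s" "axial s = - 2 * \<epsilon> * g s"
proof -
  have par: "f r * f' r = g r * g' r" if r: "r \<in> {a<..<b}" for r
  proof -
    have "2 * (f r * f' r) - 2 * (g r * g' r) = 0"
      by (rule deriv_eq_if_eq_on_interval[of a b "\<lambda>r. (f r)\<^sup>2 - (g r)\<^sup>2" "\<lambda>_. k", OF _ r])
         (use k in \<open>auto intro!: derivative_eq_intros deriv_f deriv_g r\<close>)
    then show ?thesis by simp
  qed
  have second: "f' r * f' r + f r * (\<kappa> r * g' r) = g' r * g' r + g r * (\<kappa> r * f' r)"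
    if r: "r \<in> {a<..<b}" for r
    by (rule deriv_eq_if_eq_on_interval[of a b "\<lambda>r. f r * f' r" "\<lambda>r. g r * g' r", OF _ r])
       (use par in \<open>auto intro!: derivative_eq_intros deriv_f deriv_g deriv_f' deriv_g' r\<close>)
  \<comment> \<open>The two principal radii \<open>1 / \<kappa>\<close> and \<open>f / g'\<close> agree.\<close>
  have rho: "\<kappa> r * f r = g' r" if r: "r \<in> {a<..<b}" for r
  proof -
    have "g' r * ((f' r)\<^sup>2 - (g' r)\<^sup>2) + \<kappa> r * (f r * g' r * g' r - (g r * g' r) * f' r) = 0"
      using arg_cong[OF second[OF r], of "\<lambda>x. g' r * x"]
      by (simp add: algebra_simps power2_eq_square)
    then have "g' r * \<epsilon> - \<kappa> r * f r * ((f' r)\<^sup>2 - (g' r)\<^sup>2) = 0"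
      unfolding par[OF r, symmetric] unit[OF r] by (simp add: unit[OF r, symmetric] algebra_simps power2_eq_square)
    then show ?thesis unfolding unit[OF r] using eps_nz by simp
  qed
  have radii_sum: "radii_sum r = 2 * f r / g' r" if r: "r \<in> {a<..<b}" for r
    using rho[OF r] g'_nz[OF r] \<kappa>_nz[OF r] by (simp add: radii_sum_def field_simps)
  have "radii_sum' s = 2 * (f' s * g' s - f s * (\<kappa> s * f' s)) / (g' s)\<^sup>2"
    by (rule deriv_eq_if_eq_on_interval[OF radii_sum s deriv_radii_sum[OF s]])
       (auto intro!: derivative_eq_intros deriv_f deriv_g' s g'_nz simp: field_simps power2_eq_square)
  also have "f' s * g' s - f s * (\<kappa> s * f' s) = f' s * (g' s - \<kappa> s * f s)"
    by (simp add: algebra_simps)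
  finally have R': "radii_sum' s = 0" using rho[OF s] by simp
  have "f' s * (2 * f s / g' s) = 2 * (f s * f' s) / g' s" by simp
  also have "\<dots> = 2 * g s" unfolding par[OF s] using g'_nz[OF s] by simp
  finally have "f' s * radii_sum s = 2 * g s" unfolding radii_sum[OF s] .
  moreover have "g' s * radii_sum s = 2 * f s" unfolding radii_sum[OF s] using g'_nz[OF s] by simp
  ultimately show "radial s = - 2 * \<epsilon> * f s" "axial s = - 2 * \<epsilon> * g s"
    using radial_axial_from_components[OF s] by (simp_all add: R')
qed

end

section \<open>Profiles whose Laplacian is a diagonal matrix applied to the position\<close>

text \<open>The right-hand side of the last hypothesis looks cubic in \<open>t\<close> but is quadratic: it equals
  \<open>\<epsilon> \<nu> d - 2 t (t - \<epsilon>) (\<nu> d' - d \<nu>')\<close>, where \<open>\<nu> d' - d \<nu>'\<close> is constant because \<open>d\<close> and \<open>\<nu>\<close> are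
  linear in \<open>t\<close>. The difference of the two sides is \<open>- \<epsilon>\<close> times the quadratic in the conclusion.\<close>

lemma elimination_identity:
  fixes \<alpha> \<beta> \<gamma> \<delta> \<epsilon> t :: real
  assumes "\<epsilon> * \<epsilon> = 1" "\<alpha> = \<delta> + \<gamma>" "\<beta> = \<delta> - \<gamma>"
    and "d = \<gamma> * \<alpha> * (t - \<epsilon>) + \<delta>" "\<nu> = \<beta> * (1 + \<gamma> * t)" "B = - \<beta> * (1 + \<epsilon> * \<alpha>)"
    and "B * (t * d - (t - \<epsilon>) * \<nu>)
       = t * d * (\<nu> + 2 * \<beta> * \<gamma> * (t - \<epsilon>)) - (t - \<epsilon>) * \<nu> * (d + 2 * \<gamma> * \<alpha> * t)"
  shows "\<alpha> * \<beta> * \<gamma>\<^sup>2 * t\<^sup>2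
         + \<beta> * \<gamma> * (\<epsilon> * (1 + \<epsilon> * \<alpha>) + \<alpha> + \<delta> - \<epsilon> * \<gamma> * \<alpha>) * t
         + \<beta> * (\<beta> * (1 + \<epsilon> * \<alpha>) + \<delta> - \<epsilon> * \<gamma> * \<alpha>) = 0"
  using assms by algebra

locale eigenprofile = profile +
  fixes \<alpha> \<beta> :: real
  assumes radial_eq: "s \<in> {a<..<b} \<Longrightarrow> radial s = \<alpha> * f s"
    and axial_eq: "s \<in> {a<..<b} \<Longrightarrow> axial s = \<beta> * g s"
begin

lemma radii_sum_eq:
  assumes s: "s \<in> {a<..<b}"
  shows "radii_sum s = \<alpha> * f s * g' s - \<beta> * g s * f' s"
  using normal_component[OF s] radial_eq[OF s] axial_eq[OF s] by (simp add: algebra_simps)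

lemma radii_sum'_eq_tangential:
  assumes s: "s \<in> {a<..<b}"
  shows "radii_sum' s = - \<kappa> s * (\<alpha> * f s * f' s - \<beta> * g s * g' s)"
  using tangential_component[OF s] radial_eq[OF s] axial_eq[OF s] \<kappa>_nz[OF s]
  by (simp add: field_simps)

text \<open>The normal component gives \<open>W\<close> in terms of \<open>f\<close>, \<open>g\<close> and their derivatives. Its
  derivative is \<open>(\<alpha> - \<beta>) f' g'\<close> plus \<open>\<kappa>\<close> times the tangential component, and the latter product is
  \<open>- W'\<close>; so \<open>f\<close> and \<open>g\<close> drop out.\<close>

lemma radii_sum'_eq:
  assumes s: "s \<in> {a<..<b}"
  shows "2 * radii_sum' s = (\<alpha> - \<beta>) * (f' s * g' s)"
proof -
  have "radii_sum' s = \<alpha> * (f' s * g' s + f s * (\<kappa> s * f' s)) - \<beta> * (g' s * f' s + g s * (\<kappa> s * g' s))"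
    by (rule deriv_eq_if_eq_on_interval[OF radii_sum_eq s deriv_radii_sum[OF s]])
       (auto intro!: derivative_eq_intros deriv_f deriv_f' deriv_g deriv_g' s simp: algebra_simps)
  then show ?thesis using radii_sum'_eq_tangential[OF s] by (simp add: algebra_simps)
qed

text \<open>For equal eigenvalues \<open>\<alpha> = \<beta>\<close> the sum of the radii is constant, so \<open>\<alpha> (f f' - g g') = 0\<close>.
  Either \<open>\<alpha> = 0\<close>, and then the sum of the radii is zero, or \<open>f\<^sup>2 - g\<^sup>2\<close> is a constant. That constant
  is not \<open>0\<close>, since a null line through the origin has \<open>f'\<^sup>2 = g'\<^sup>2\<close>.\<close>

lemma equal_eigenvalues_cases:
  assumes "\<alpha> = \<beta>"
  shows "(\<forall>s\<in>{a<..<b}. radii_sum s = 0) \<or> (\<exists>k. k \<noteq> 0 \<and> (\<forall>s\<in>{a<..<b}. (f s)\<^sup>2 - (g s)\<^sup>2 = k))"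
proof (cases "\<alpha> = 0")
  case True
  then show ?thesis using assms radii_sum_eq by auto
next
  case False
  have par: "f s * f' s = g s * g' s" if s: "s \<in> {a<..<b}" for s
  proof -
    have "\<alpha> * f s * f' s - \<beta> * g s * g' s = 0"
      using radii_sum'_eq[OF s] radii_sum'_eq_tangential[OF s] assms \<kappa>_nz[OF s] by auto
    then have "\<alpha> * (f s * f' s) = \<alpha> * (g s * g' s)"
      using assms by (simp only: mult.assoc right_minus_eq)
    then show ?thesis using False by simp
  qed
  have D: "((\<lambda>s. (f s)\<^sup>2 - (g s)\<^sup>2) has_real_derivative 0) (at s)" if s: "s \<in> {a<..<b}" for s
    by (rule derivative_eq_intros deriv_f deriv_g s refl)+ (use par[OF s] in \<open>simp add: mult.commute[of "f' s"] mult.commute[of "g' s"]\<close>)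
  have "(\<lambda>s. (f s)\<^sup>2 - (g s)\<^sup>2) constant_on {a<..<b}"
    by (rule has_field_derivative_0_imp_constant_on[OF D]) auto
  then obtain k where k: "\<And>s. s \<in> {a<..<b} \<Longrightarrow> (f s)\<^sup>2 - (g s)\<^sup>2 = k"
    unfolding constant_on_def by blast
  have "k \<noteq> 0"
  proof
    assume "k = 0"
    obtain s where s: "s \<in> {a<..<b}" using ab dense by auto
    have fg: "(f s)\<^sup>2 = (g s)\<^sup>2" using k[OF s] \<open>k = 0\<close> by simp
    have "(f s)\<^sup>2 * ((f' s)\<^sup>2 - (g' s)\<^sup>2) = (f s * f' s)\<^sup>2 - (f s)\<^sup>2 * (g' s)\<^sup>2"
      by (simp add: algebra_simps power_mult_distrib)
    also have "\<dots> = 0" by (simp add: par[OF s] fg power_mult_distrib)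
    finally show False using unit[OF s] eps_nz f_nz[OF s] by simp
  qed
  then show ?thesis using k by blast
qed

text \<open>The rest of this part shows that the eigenvalues \<open>\<alpha>\<close> and \<open>\<beta>\<close> cannot differ. Half their
  difference \<open>\<gamma>\<close> and half their sum \<open>\<delta>\<close> are the natural parameters.\<close>

abbreviation \<gamma> where "\<gamma> \<equiv> (\<alpha> - \<beta>) / 2"
abbreviation \<delta> where "\<delta> \<equiv> (\<alpha> + \<beta>) / 2"

lemma radius_eq:
  assumes s: "s \<in> {a<..<b}"
  shows "g' s / \<kappa> s = f s * (\<alpha> * (g' s)\<^sup>2 - 1) - \<beta> * g s * f' s * g' s"
proof -
  have "g' s * radii_sum s = g' s / \<kappa> s + f s" using g'_nz[OF s] \<kappa>_nz[OF s]
    by (simp add: radii_sum_def field_simps)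
  then show ?thesis using radii_sum_eq[OF s] by (simp add: algebra_simps power2_eq_square)
qed

text \<open>The two expressions for \<open>W'\<close>, together with the formula for the radius \<open>1 / \<kappa>\<close>, leave a relation
  without \<open>\<kappa>\<close>: it fixes the ratio of \<open>f\<close> and \<open>g\<close> as a rational function on the hyperbola of
  \<open>(f', g')\<close>.\<close>

lemma algebraic_relation:
  assumes s: "s \<in> {a<..<b}"
  shows "f s * f' s * (\<gamma> * \<alpha> * (g' s)\<^sup>2 + \<delta>) = g s * (\<beta> * g' s * (1 + \<gamma> * (f' s)\<^sup>2))"
proof -
  have "\<gamma> * f' s * (g' s / \<kappa> s) = - (\<alpha> * f s * f' s - \<beta> * g s * g' s)"
    using radii_sum'_eq[OF s] radii_sum'_eq_tangential[OF s] \<kappa>_nz[OF s] by (simp add: field_simps)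
  then show ?thesis unfolding radius_eq[OF s]
    by (simp add: field_simps power2_eq_square)
qed

lemma algebraic_relation_deriv:
  assumes s: "s \<in> {a<..<b}"
  shows "f' s * (f' s * (\<gamma> * \<alpha> * (g' s)\<^sup>2 + \<delta>))
         + \<kappa> s * f s * g' s * (\<gamma> * \<alpha> * (g' s)\<^sup>2 + \<delta> + 2 * \<gamma> * \<alpha> * (f' s)\<^sup>2)
       = g' s * (\<beta> * g' s * (1 + \<gamma> * (f' s)\<^sup>2))
         + \<kappa> s * g s * f' s * (\<beta> * (1 + \<gamma> * (f' s)\<^sup>2) + 2 * \<beta> * \<gamma> * (g' s)\<^sup>2)"
  by (rule deriv_eq_if_eq_on_interval[OF algebraic_relation s])
     (auto intro!: derivative_eq_intros deriv_f deriv_f' deriv_g deriv_g' s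
       simp: field_simps power2_eq_square)

text \<open>The derivative of the algebraic relation involves \<open>\<kappa>\<close> only through the radius \<open>1 / \<kappa>\<close>, which
  is itself linear in \<open>f\<close> and \<open>g\<close>. Using the relation once more to replace \<open>f\<close>, everything becomes a
  multiple of \<open>g\<close>; the cofactor is a polynomial in \<open>t = f'\<^sup>2\<close> alone, as \<open>g'\<^sup>2 = t - \<epsilon>\<close>.\<close>

lemma polynomial_identity:
  assumes s: "s \<in> {a<..<b}" and gs: "g s \<noteq> 0"
  defines "t \<equiv> (f' s)\<^sup>2"
  shows "\<alpha> * \<beta> * \<gamma>\<^sup>2 * t\<^sup>2
         + \<beta> * \<gamma> * (\<epsilon> * (1 + \<epsilon> * \<alpha>) + \<alpha> + \<delta> - \<epsilon> * \<gamma> * \<alpha>) * t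
         + \<beta> * (\<beta> * (1 + \<epsilon> * \<alpha>) + \<delta> - \<epsilon> * \<gamma> * \<alpha>) = 0"
proof -
  define d where "d = \<gamma> * \<alpha> * (t - \<epsilon>) + \<delta>"
  define \<nu> where "\<nu> = \<beta> * (1 + \<gamma> * t)"
  have g2: "(g' s)\<^sup>2 = t - \<epsilon>" using unit[OF s] by (simp add: t_def)
  define \<rho> where "\<rho> = 1 / \<kappa> s"
  have rel: "f s * f' s * d = g s * g' s * \<nu>"
    using algebraic_relation[OF s] by (simp add: g2 d_def \<nu>_def t_def[symmetric])
  have \<rho>: "\<rho> * g' s = f s * (\<alpha> * (t - \<epsilon>) - 1) - \<beta> * g s * f' s * g' s"
    using radius_eq[OF s] by (simp add: g2 \<rho>_def)
  have "t * d + \<kappa> s * (f s * g' s * (d + 2 * \<gamma> * \<alpha> * t))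
      = (t - \<epsilon>) * \<nu> + \<kappa> s * (g s * f' s * (\<nu> + 2 * \<beta> * \<gamma> * (t - \<epsilon>)))"
  proof -
    have t1: "t * x = f' s * (f' s * x)" for x by (simp add: t_def power2_eq_square)
    have t2: "(t - \<epsilon>) * x = g' s * (g' s * x)" for x
      unfolding g2[symmetric] by (simp add: power2_eq_square)
    show ?thesis
      using algebraic_relation_deriv[OF s, folded t_def, unfolded g2, folded d_def]
      unfolding t1 t2 \<nu>_def by (simp only: ac_simps)
  qed
  then have "\<rho> * (t * d) + \<rho> * \<kappa> s * (f s * g' s * (d + 2 * \<gamma> * \<alpha> * t))
      = \<rho> * ((t - \<epsilon>) * \<nu>) + \<rho> * \<kappa> s * (g s * f' s * (\<nu> + 2 * \<beta> * \<gamma> * (t - \<epsilon>)))"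
    unfolding mult.assoc[of \<rho>] distrib_left[symmetric] by simp
  then have rel': "\<rho> * (t * d - (t - \<epsilon>) * \<nu>)
      = g s * f' s * (\<nu> + 2 * \<beta> * \<gamma> * (t - \<epsilon>)) - f s * g' s * (d + 2 * \<gamma> * \<alpha> * t)"
    using \<kappa>_nz[OF s] by (simp add: \<rho>_def right_diff_distrib)
  \<comment> \<open>All terms in \<open>t\<close> cancel in \<open>B\<close>: this is what keeps the final degree low.\<close>
  define B where "B = - \<beta> * (1 + \<epsilon> * \<alpha>)"
  have B: "\<nu> * (\<alpha> * (t - \<epsilon>) - 1) - \<beta> * (t * d) = B"
    by (simp add: \<nu>_def d_def B_def field_simps)
  have "g' s * (\<rho> * f' s * d) = (\<rho> * g' s) * (f' s * d)" by simp
  also have "\<dots> = (f s * f' s * d) * (\<alpha> * (t - \<epsilon>) - 1) - g s * g' s * (\<beta> * (t * d))"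
    unfolding \<rho> by (simp add: t_def algebra_simps power2_eq_square)
  also have "\<dots> = g' s * (g s * B)" unfolding rel B[symmetric] by (simp add: algebra_simps)
  finally have \<rho>B: "\<rho> * f' s * d = g s * B" using g'_nz[OF s] by simp
  have "g s * (B * (t * d - (t - \<epsilon>) * \<nu>)) = f' s * d * (\<rho> * (t * d - (t - \<epsilon>) * \<nu>))"
    unfolding mult.assoc[symmetric] \<rho>B[symmetric] by simp
  also have "\<dots> = g s * ((f' s)\<^sup>2 * d * (\<nu> + 2 * \<beta> * \<gamma> * (t - \<epsilon>)))
      - (f s * f' s * d) * (g' s * (d + 2 * \<gamma> * \<alpha> * t))"
    unfolding rel' by (simp only: right_diff_distrib power2_eq_square ac_simps)
  also have "\<dots> = g s * ((f' s)\<^sup>2 * d * (\<nu> + 2 * \<beta> * \<gamma> * (t - \<epsilon>)))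
      - g s * ((g' s)\<^sup>2 * \<nu> * (d + 2 * \<gamma> * \<alpha> * t))"
    unfolding rel by (simp only: power2_eq_square ac_simps)
  finally have "B * (t * d - (t - \<epsilon>) * \<nu>)
      = t * d * (\<nu> + 2 * \<beta> * \<gamma> * (t - \<epsilon>)) - (t - \<epsilon>) * \<nu> * (d + 2 * \<gamma> * \<alpha> * t)"
    using gs unfolding right_diff_distrib[symmetric] g2 t_def[symmetric] by simp
  then show ?thesis
    by (intro elimination_identity[OF eps_sq _ _ d_def \<nu>_def B_def]) (simp_all add: field_simps)
qed

text \<open>The function \<open>g\<close> is injective, hence has at most one zero, and \<open>f'\<close> is injective too.\<close>

lemma polynomial_zero_if_vanishes_at_f':
  assumes *: "\<And>s. s \<in> {a<..<b} \<Longrightarrow> g s \<noteq> 0 \<Longrightarrow> poly p (f' s) = 0"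
  shows "p = 0"
proof (rule ccontr)
  assume "p \<noteq> 0"
  define S where "S = {s \<in> {a<..<b}. g s \<noteq> 0}"
  define Z where "Z = {s \<in> {a<..<b}. g s = 0}"
  have "finite Z"
  proof (rule finite_imageD)
    show "finite (g ` Z)" by (rule finite_subset[of _ "{0}"]) (auto simp: Z_def)
    show "inj_on g Z" by (rule inj_on_subset[OF inj_g]) (auto simp: Z_def)
  qed
  moreover have "finite S"
  proof (rule finite_imageD)
    show "finite (f' ` S)"
      by (rule finite_subset[OF _ poly_roots_finite[OF \<open>p \<noteq> 0\<close>]]) (use * in \<open>auto simp: S_def\<close>)
    show "inj_on f' S" by (rule inj_on_subset[OF inj_f']) (auto simp: S_def)
  qed
  moreover have "{a<..<b} = S \<union> Z" by (auto simp: S_def Z_def)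
  ultimately have "finite {a<..<b}" by simp
  then show False using ab infinite_Ioo by blast
qed

text \<open>If \<open>\<gamma> \<noteq> 0\<close>, all coefficients of the polynomial identity vanish. The leading one gives
  \<open>\<alpha> = 0\<close> or \<open>\<beta> = 0\<close>. In the first case the two others are incompatible with \<open>\<beta> \<noteq> 0\<close>. In the second
  case the identity is void, but the algebraic relation itself loses its right-hand side and becomes a
  nontrivial polynomial equation for \<open>f'\<close>.\<close>

lemma eigenvalues_equal: "\<alpha> = \<beta>"
proof (rule ccontr)
  assume "\<alpha> \<noteq> \<beta>"
  then have \<gamma>: "\<gamma> \<noteq> 0" by simp
  define K2 K1 K0 where "K2 = \<alpha> * \<beta> * \<gamma>\<^sup>2"
    and "K1 = \<beta> * \<gamma> * (\<epsilon> * (1 + \<epsilon> * \<alpha>) + \<alpha> + \<delta> - \<epsilon> * \<gamma> * \<alpha>)"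
    and "K0 = \<beta> * (\<beta> * (1 + \<epsilon> * \<alpha>) + \<delta> - \<epsilon> * \<gamma> * \<alpha>)"
  have "poly [:K0, 0, K1, 0, K2:] (f' s) = 0" if "s \<in> {a<..<b}" "g s \<noteq> 0" for s
  proof -
    have "K2 * ((f' s)\<^sup>2)\<^sup>2 + K1 * (f' s)\<^sup>2 + K0 = 0"
      unfolding K2_def K1_def K0_def by (rule polynomial_identity[OF that])
    then show ?thesis by (simp add: algebra_simps power2_eq_square)
  qed
  then have "[:K0, 0, K1, 0, K2:] = 0" by (rule polynomial_zero_if_vanishes_at_f')
  then have K: "K2 = 0" "K1 = 0" "K0 = 0" by simp_all
  show False
  proof (cases "\<beta> = 0")
    case False
    then have \<alpha>: "\<alpha> = 0" using K(1) \<gamma> by (simp add: K2_def)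
    have "\<epsilon> + \<delta> = 0" using K(2) False \<gamma> by (simp add: K1_def \<alpha>)
    moreover have "\<beta> + \<delta> = 0" using K(3) False by (simp add: K0_def \<alpha>)
    ultimately show False using False \<alpha> by simp
  next
    case True
    have "poly [:0, 1 - \<alpha> * \<epsilon>, 0, \<alpha>:] (f' s) = 0" if "s \<in> {a<..<b}" "g s \<noteq> 0" for s
    proof -
      have "f s * (\<alpha> * (f' s * (\<alpha> * (g' s)\<^sup>2 + 1))) = 0"
        using algebraic_relation[OF that(1)] by (simp add: True field_simps)
      then have "\<alpha> * (f' s * (\<alpha> * (g' s)\<^sup>2 + 1)) = 0" using f_nz[OF that(1)] by simp
      then have "f' s * (\<alpha> * ((f' s)\<^sup>2 - \<epsilon>) + 1) = 0"
        using unit[OF that(1)] \<gamma> True by auto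
      then show ?thesis by (simp add: algebra_simps power2_eq_square)
    qed
    then have "[:0, 1 - \<alpha> * \<epsilon>, 0, \<alpha>:] = 0" by (rule polynomial_zero_if_vanishes_at_f')
    then show False using \<gamma> True by simp
  qed
qed

end

context profile
begin

lemma eigenprofile_iff:
  "(\<exists>\<alpha> \<beta>. eigenprofile a b \<epsilon> f g f' g' \<kappa> \<kappa>' \<alpha> \<beta>) \<longleftrightarrow>
   (\<exists>k. k \<noteq> 0 \<and> (\<forall>s\<in>{a<..<b}. (f s)\<^sup>2 - (g s)\<^sup>2 = k)) \<or> (\<forall>s\<in>{a<..<b}. radii_sum s = 0)"
proof
  assume "\<exists>\<alpha> \<beta>. eigenprofile a b \<epsilon> f g f' g' \<kappa> \<kappa>' \<alpha> \<beta>"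
  then obtain \<alpha> \<beta> where "eigenprofile a b \<epsilon> f g f' g' \<kappa> \<kappa>' \<alpha> \<beta>" by blast
  then interpret eigenprofile a b \<epsilon> f g f' g' \<kappa> \<kappa>' \<alpha> \<beta> .
  show "(\<exists>k. k \<noteq> 0 \<and> (\<forall>s\<in>{a<..<b}. (f s)\<^sup>2 - (g s)\<^sup>2 = k)) \<or> (\<forall>s\<in>{a<..<b}. radii_sum s = 0)"
    using equal_eigenvalues_cases[OF eigenvalues_equal] by blast
next
  assume "(\<exists>k. k \<noteq> 0 \<and> (\<forall>s\<in>{a<..<b}. (f s)\<^sup>2 - (g s)\<^sup>2 = k)) \<or> (\<forall>s\<in>{a<..<b}. radii_sum s = 0)"
  then show "\<exists>\<alpha> \<beta>. eigenprofile a b \<epsilon> f g f' g' \<kappa> \<kappa>' \<alpha> \<beta>"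
  proof
    assume "\<exists>k. k \<noteq> 0 \<and> (\<forall>s\<in>{a<..<b}. (f s)\<^sup>2 - (g s)\<^sup>2 = k)"
    then obtain k where k: "\<And>s. s \<in> {a<..<b} \<Longrightarrow> (f s)\<^sup>2 - (g s)\<^sup>2 = k" by blast
    have "eigenprofile a b \<epsilon> f g f' g' \<kappa> \<kappa>' (- 2 * \<epsilon>) (- 2 * \<epsilon>)"
      by unfold_locales (use hyperbola_imp_eigen[OF k] in auto)
    then show ?thesis by blast
  next
    assume "\<forall>s\<in>{a<..<b}. radii_sum s = 0"
    then have "eigenprofile a b \<epsilon> f g f' g' \<kappa> \<kappa>' 0 0"
      by unfold_locales (use minimal_imp_harmonic in auto)
    then show ?thesis by blast
  qed
qed

end

section \<open>Partial derivatives of rotationally symmetric fields\<close>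

lemma strip_iff: "u \<in> param_strip a b \<longleftrightarrow> u $ 1 \<in> {a<..<b}"
  by (simp add: param_strip_def)

lemma open_param_strip: "open (param_strip a b)"
  unfolding param_strip_def by (intro open_Collect_conj open_Collect_less continuous_intros)

lemma connected_param_strip: "connected (param_strip a b)"
proof -
  have "param_strip a b = (\<lambda>u. u $ 1) -` {a<..<b}" by (auto simp: param_strip_def)
  moreover have "linear (\<lambda>u :: real^2. u $ 1)" by (simp add: linear_iff)
  ultimately have "convex (param_strip a b)"
    using convex_linear_vimage[of "\<lambda>u :: real^2. u $ 1" "{a<..<b}"] by simp
  then show ?thesis by (rule convex_connected)
qed

lemma pdv_eqI:
  assumes "open D" "u \<in> D" "\<And>v. v \<in> D \<Longrightarrow> p v = q v"
    and "((\<lambda>t. q (u + t *\<^sub>R axis k 1)) has_vector_derivative d) (at 0)"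
  shows "pdv p k u = d"
proof -
  have "open ((\<lambda>t. u + t *\<^sub>R axis k 1) -` D)"
    using assms(1) by (rule open_vimage) (intro continuous_intros)
  then have "((\<lambda>t. p (u + t *\<^sub>R axis k 1)) has_vector_derivative d) (at 0)"
    by (rule has_vector_derivative_transform_within_open[OF assms(4)]) (use assms in auto)
  then show ?thesis unfolding pdv_def by (rule vector_derivative_at)
qed

lemma line_coordinates:
  fixes u :: "real^2"
  shows
  "(u + t *\<^sub>R axis 1 1) $ 1 = u $ 1 + t" "(u + t *\<^sub>R axis 1 1) $ 2 = u $ 2"
  "(u + t *\<^sub>R axis 2 1) $ 1 = u $ 1" "(u + t *\<^sub>R axis 2 1) $ 2 = u $ 2 + t"
  "axis 1 1 $ (2 :: 2) = (0 :: real)" "axis 2 1 $ (1 :: 2) = (0 :: real)"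
  by (simp_all add: axis_def)

lemma deriv_shift_0:
  "(q has_real_derivative d) (at x) \<Longrightarrow> ((\<lambda>t. q (x + t)) has_real_derivative d) (at 0)"
  using DERIV_shift[of q d 0 x] by (simp add: add.commute)

lemma has_vector_derivative_vector3:
  fixes p q r :: "real \<Rightarrow> real"
  assumes "(p has_real_derivative p') (at x)" "(q has_real_derivative q') (at x)"
    "(r has_real_derivative r') (at x)"
  shows "((\<lambda>t. vector [p t, q t, r t] :: real^3) has_vector_derivative vector [p', q', r']) (at x)"
proof -
  have v: "(vector [x, y, z] :: real^3) = x *\<^sub>R axis 1 1 + y *\<^sub>R axis 2 1 + z *\<^sub>R axis 3 1" for x y z
    by (simp add: vec_eq_iff forall_3 axis_def)
  show ?thesis unfolding v
    by (rule derivative_eq_intros assms refl)+ simp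
qed

lemma pdv_product:
  fixes p :: "real^2 \<Rightarrow> real" and q T :: "real \<Rightarrow> real"
  assumes "u \<in> param_strip a b" "\<And>v. v \<in> param_strip a b \<Longrightarrow> p v = q (v $ 1) * T (v $ 2)"
  shows "(q has_real_derivative q') (at (u $ 1)) \<Longrightarrow> pdv p 1 u = q' * T (u $ 2)"
    and "(T has_real_derivative T') (at (u $ 2)) \<Longrightarrow> pdv p 2 u = q (u $ 1) * T'"
proof -
  assume "(q has_real_derivative q') (at (u $ 1))"
  from DERIV_cmult_right[OF deriv_shift_0[OF this], of "T (u $ 2)"]
  show "pdv p 1 u = q' * T (u $ 2)"
    by (intro pdv_eqI[OF open_param_strip assms])
       (simp_all add: line_coordinates has_real_derivative_iff_has_vector_derivative)
next
  assume "(T has_real_derivative T') (at (u $ 2))"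
  from DERIV_cmult[OF deriv_shift_0[OF this], of "q (u $ 1)"]
  show "pdv p 2 u = q (u $ 1) * T'"
    by (intro pdv_eqI[OF open_param_strip assms])
       (simp_all add: line_coordinates has_real_derivative_iff_has_vector_derivative)
qed

text \<open>Together with the fields \<open>surf_rev q r\<close>, which lie in the meridian half-planes, the fields
  tangent to the parallels are closed under partial differentiation, and the two kinds are orthogonal.
  All vectors attached to the surface are of one of these two kinds.\<close>

definition parallel_field :: "(real \<Rightarrow> real) \<Rightarrow> real^2 \<Rightarrow> real^3" where
  "parallel_field q u = vector [- q (u $ 1) * sin (u $ 2), q (u $ 1) * cos (u $ 2), 0]"

lemma pdv_surf_rev:
  assumes "u \<in> param_strip a b" "\<And>v. v \<in> param_strip a b \<Longrightarrow> p v = surf_rev q r v"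
  shows "(q has_real_derivative q' (u $ 1)) (at (u $ 1)) \<Longrightarrow>
         (r has_real_derivative r' (u $ 1)) (at (u $ 1)) \<Longrightarrow> pdv p 1 u = surf_rev q' r' u"
    and "pdv p 2 u = parallel_field q u"
proof -
  assume "(q has_real_derivative q' (u $ 1)) (at (u $ 1))" "(r has_real_derivative r' (u $ 1)) (at (u $ 1))"
  note d = this[THEN deriv_shift_0]
  show "pdv p 1 u = surf_rev q' r' u"
    by (rule pdv_eqI[OF open_param_strip assms])
       (auto simp: surf_rev_def line_coordinates
         intro!: has_vector_derivative_vector3 derivative_eq_intros d)
next
  show "pdv p 2 u = parallel_field q u"
    by (rule pdv_eqI[OF open_param_strip assms])
       (auto simp: surf_rev_def parallel_field_def line_coordinates
         intro!: has_vector_derivative_vector3 derivative_eq_intros)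
qed

lemma pdv_parallel_field:
  assumes "u \<in> param_strip a b" "\<And>v. v \<in> param_strip a b \<Longrightarrow> p v = parallel_field q v"
  shows "pdv p 2 u = surf_rev (\<lambda>s. - q s) (\<lambda>_. 0) u"
  by (rule pdv_eqI[OF open_param_strip assms])
     (auto simp: surf_rev_def parallel_field_def line_coordinates
       intro!: has_vector_derivative_vector3 derivative_eq_intros)

lemma lorentz_rotational:
  "lorentz (surf_rev q r u) (surf_rev p w u) = q (u $ 1) * p (u $ 1) - r (u $ 1) * w (u $ 1)"
  "lorentz (surf_rev q r u) (parallel_field p u) = 0"
  "lorentz (parallel_field p u) (surf_rev q r u) = 0"
  "lorentz (parallel_field p u) (parallel_field q u) = p (u $ 1) * q (u $ 1)"
proof -
  have "x * cos t * (y * cos t) + x * sin t * (y * sin t) = x * y"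
    "x * sin t * (y * sin t) + x * cos t * (y * cos t) = x * y" for x y t :: real
    using sin_cos_squared_add3[of t] by (metis (no_types, opaque_lifting) add.commute distrib_left mult.left_commute mult.commute mult.right_neutral)+
  then show
  "lorentz (surf_rev q r u) (surf_rev p w u) = q (u $ 1) * p (u $ 1) - r (u $ 1) * w (u $ 1)"
  "lorentz (parallel_field p u) (parallel_field q u) = p (u $ 1) * q (u $ 1)"
    by (simp_all add: lorentz_def surf_rev_def parallel_field_def)
qed (simp_all add: lorentz_def surf_rev_def parallel_field_def)

definition diag2 :: "real \<Rightarrow> real \<Rightarrow> real^2^2" where
  "diag2 x y = (\<chi> k m. if k = m then (if k = 1 then x else y) else 0)"

lemma det_diag2: "det (diag2 x y) = x * y"
  by (simp add: det_2 diag2_def)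

lemma diag2_nth: "diag2 x y $ 1 $ 1 = x" "diag2 x y $ 2 $ 2 = y"
  "diag2 x y $ 1 $ 2 = 0" "diag2 x y $ 2 $ 1 = 0"
  by (simp_all add: diag2_def)

lemma matrix_inv_diag2:
  assumes "x \<noteq> 0" "y \<noteq> 0"
  shows "matrix_inv (diag2 x y) = diag2 (1 / x) (1 / y)"
proof -
  let ?A = "diag2 x y" and ?B = "diag2 (1 / x) (1 / y)"
  have BA: "?B ** ?A = mat 1" "?A ** ?B = mat 1" using assms
    by (simp_all add: vec_eq_iff forall_2 matrix_matrix_mult_def sum_2 diag2_nth mat_def)
  then have "?A ** matrix_inv ?A = mat 1"
    unfolding matrix_inv_def by (metis (mono_tags, lifting) someI_ex)
  then have "?B ** (?A ** matrix_inv ?A) = ?B" by simp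
  then show ?thesis using BA by (simp add: matrix_mul_assoc)
qed

section \<open>The unit normal and the second fundamental form\<close>

context unit_speed_profile
begin

lemma deriv_surf_rev:
  assumes u: "u \<in> param_strip a b"
  shows "pdv (surf_rev f g) 1 u = surf_rev f' g' u"
    and "pdv (surf_rev f g) 2 u = parallel_field f u"
    and "pdv (pdv (surf_rev f g) 1) 1 u = surf_rev (\<lambda>s. \<kappa> s * g' s) (\<lambda>s. \<kappa> s * f' s) u"
    and "pdv (pdv (surf_rev f g) 1) 2 u = parallel_field f' u"
    and "pdv (pdv (surf_rev f g) 2) 2 u = surf_rev (\<lambda>s. - f s) (\<lambda>_. 0) u"
proof -
  have x1: "pdv (surf_rev f g) 1 v = surf_rev f' g' v"
    and x2: "pdv (surf_rev f g) 2 v = parallel_field f v" if "v \<in> param_strip a b" for v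
    using that by (auto intro!: pdv_surf_rev deriv_f deriv_g simp: strip_iff)
  show "pdv (surf_rev f g) 1 u = surf_rev f' g' u" "pdv (surf_rev f g) 2 u = parallel_field f u"
    using x1 x2 u by auto
  show "pdv (pdv (surf_rev f g) 1) 1 u = surf_rev (\<lambda>s. \<kappa> s * g' s) (\<lambda>s. \<kappa> s * f' s) u"
    using u by (auto intro!: pdv_surf_rev(1)[OF u x1] deriv_f' deriv_g' simp: strip_iff)
  show "pdv (pdv (surf_rev f g) 1) 2 u = parallel_field f' u"
    by (rule pdv_surf_rev(2)[OF u x1])
  show "pdv (pdv (surf_rev f g) 2) 2 u = surf_rev (\<lambda>s. - f s) (\<lambda>_. 0) u"
    by (rule pdv_parallel_field[OF u x2])
qed

text \<open>The orthogonality conditions determine \<open>n\<close> at each point as \<open>\<tau>\<close> times the explicit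
  normal \<open>(g' cos \<theta>, g' sin \<theta>, f')\<close> with \<open>\<tau>\<^sup>2 = 1\<close>. As \<open>\<tau>\<close> is continuous and the strip is
  connected, the sign is the same everywhere.\<close>

lemma unit_normal_rotational:
  assumes n: "unit_normal_field_on (param_strip a b) (surf_rev f g) n"
  obtains \<sigma> where "\<sigma> * \<sigma> = 1"
    and "\<And>u. u \<in> param_strip a b \<Longrightarrow> n u = surf_rev (\<lambda>s. \<sigma> * g' s) (\<lambda>s. \<sigma> * f' s) u"
proof -
  \<comment> \<open>The explicit normal has Lorentzian square \<open>- \<epsilon>\<close>, which explains the factor.\<close>
  define \<tau> where "\<tau> u = - \<epsilon> * lorentz (n u) (surf_rev g' f' u)" for u
  have \<tau>: "n u = surf_rev (\<lambda>s. \<tau> u * g' s) (\<lambda>s. \<tau> u * f' s) u \<and> \<tau> u * \<tau> u = 1"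
    if u: "u \<in> param_strip a b" for u
  proof -
    define s \<theta> where "s = u $ 1" and "\<theta> = u $ 2"
    have s: "s \<in> {a<..<b}" using u by (simp add: strip_iff s_def)
    \<comment> \<open>The horizontal component of \<open>n\<close> in the meridian half-plane; the component along the parallel is \<open>0\<close>.\<close>
    define r where "r = n u $ 1 * cos \<theta> + n u $ 2 * sin \<theta>"
    have "lorentz (n u) (parallel_field f u) = 0" "lorentz (n u) (surf_rev f' g' u) = 0"
      using n u unfolding unit_normal_field_on_def by (auto simp: deriv_surf_rev)
    then have par: "f s * (n u $ 2 * cos \<theta> - n u $ 1 * sin \<theta>) = 0"
      and mer: "f' s * r = g' s * n u $ 3"
      by (simp_all add: lorentz_def surf_rev_def parallel_field_def r_def s_def[symmetric]
          \<theta>_def[symmetric] algebra_simps)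
    have par': "n u $ 2 * cos \<theta> = n u $ 1 * sin \<theta>" using par f_nz[OF s] by simp
    have n1: "n u $ 1 = r * cos \<theta>"
    proof -
      have "r * cos \<theta> = n u $ 1 * cos \<theta> * cos \<theta> + (n u $ 2 * cos \<theta>) * sin \<theta>"
        by (simp add: r_def algebra_simps)
      also have "\<dots> = n u $ 1 * ((sin \<theta>)\<^sup>2 + (cos \<theta>)\<^sup>2)"
        unfolding par' by (simp only: distrib_left power2_eq_square ac_simps)
      finally show ?thesis by simp
    qed
    have n2: "n u $ 2 = r * sin \<theta>"
    proof -
      have "r * sin \<theta> = (n u $ 1 * sin \<theta>) * cos \<theta> + n u $ 2 * sin \<theta> * sin \<theta>"
        by (simp add: r_def algebra_simps)
      also have "\<dots> = n u $ 2 * ((sin \<theta>)\<^sup>2 + (cos \<theta>)\<^sup>2)"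
        unfolding par'[symmetric] by (simp only: distrib_left power2_eq_square ac_simps)
      finally show ?thesis by simp
    qed
    have \<tau>_eq: "\<tau> u = \<epsilon> * (f' s * n u $ 3 - g' s * r)"
      by (simp add: \<tau>_def lorentz_def surf_rev_def s_def[symmetric] \<theta>_def[symmetric] r_def
          algebra_simps)
    have "\<tau> u * g' s = \<epsilon> * (f' s * (g' s * n u $ 3) - (g' s)\<^sup>2 * r)"
      by (simp add: \<tau>_eq algebra_simps power2_eq_square)
    also have "\<dots> = \<epsilon> * ((f' s)\<^sup>2 - (g' s)\<^sup>2) * r"
      unfolding mer[symmetric] by (simp add: algebra_simps power2_eq_square)
    finally have r: "\<tau> u * g' s = r" by (simp add: unit[OF s] eps_sq)
    have "\<tau> u * f' s = \<epsilon> * ((f' s)\<^sup>2 * n u $ 3 - g' s * (f' s * r))"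
      by (simp add: \<tau>_eq algebra_simps power2_eq_square)
    also have "\<dots> = \<epsilon> * ((f' s)\<^sup>2 - (g' s)\<^sup>2) * n u $ 3"
      unfolding mer by (simp add: algebra_simps power2_eq_square)
    finally have n3: "\<tau> u * f' s = n u $ 3" by (simp add: unit[OF s] eps_sq)
    have nu: "n u = surf_rev (\<lambda>s. \<tau> u * g' s) (\<lambda>s. \<tau> u * f' s) u"
      by (simp add: vec_eq_iff forall_3 surf_rev_def s_def[symmetric] \<theta>_def[symmetric] n1 n2 r n3)
    then have "lorentz (n u) (n u) = (\<tau> u * g' s)\<^sup>2 - (\<tau> u * f' s)\<^sup>2"
      by (metis (no_types, lifting) lorentz_rotational(1) power2_eq_square s_def)
    also have "\<dots> = - (\<tau> u * \<tau> u) * ((f' s)\<^sup>2 - (g' s)\<^sup>2)"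
      by (simp add: algebra_simps power2_eq_square)
    finally have "lorentz (n u) (n u) = - (\<tau> u * \<tau> u) * \<epsilon>" by (simp add: unit[OF s])
    moreover have "lorentz (n u) (n u) = 1 \<or> lorentz (n u) (n u) = -1"
      using n u by (simp add: unit_normal_field_on_def)
    ultimately have "\<tau> u * \<tau> u = 1 \<or> \<tau> u * \<tau> u = -1" using eps by auto
    moreover have "\<tau> u * \<tau> u \<ge> 0" by simp
    ultimately have "\<tau> u * \<tau> u = 1" by linarith
    with nu show ?thesis by simp
  qed
  have cont: "continuous_on (param_strip a b) \<tau>"
  proof -
    have "continuous_on {a<..<b} f'" "continuous_on {a<..<b} g'"
      by (rule continuous_on_if_deriv[OF deriv_f'] continuous_on_if_deriv[OF deriv_g'], assumption)+
    then have c: "continuous_on (param_strip a b) (\<lambda>u. f' (u $ 1))"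
      "continuous_on (param_strip a b) (\<lambda>u. g' (u $ 1))"
      by (auto intro!: continuous_on_compose2[where f = "\<lambda>u. u $ 1"] continuous_intros simp: strip_iff)
    have "continuous_on (param_strip a b) n" using n by (simp add: unit_normal_field_on_def)
    then show ?thesis unfolding \<tau>_def lorentz_def surf_rev_def vector_3
      by (intro continuous_intros c)
  qed
  have "\<tau> ` param_strip a b \<subseteq> {1, -1}"
    using \<tau> by (auto simp: square_eq_1_iff)
  then have "\<tau> constant_on param_strip a b"
    by (intro continuous_finite_range_constant connected_param_strip cont) (auto intro: finite_subset)
  then obtain \<sigma> where \<sigma>: "\<And>u. u \<in> param_strip a b \<Longrightarrow> \<tau> u = \<sigma>"
    unfolding constant_on_def by blast
  obtain s where "s \<in> {a<..<b}" using ab dense by auto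
  then have "vector [s, 0] \<in> param_strip a b" by (simp add: strip_iff)
  then show ?thesis using that[of \<sigma>] \<tau> \<sigma> by metis
qed

lemma second_form:
  assumes u: "u \<in> param_strip a b"
    and n: "n u = surf_rev (\<lambda>s. \<sigma> * g' s) (\<lambda>s. \<sigma> * f' s) u"
  shows "sf_L (surf_rev f g) n u = - (\<sigma> * \<epsilon> * \<kappa> (u $ 1))"
    and "sf_M (surf_rev f g) n u = 0"
    and "sf_N (surf_rev f g) n u = - (\<sigma> * f (u $ 1) * g' (u $ 1))"
proof -
  have "u $ 1 \<in> {a<..<b}" using u by (simp add: strip_iff)
  from unit[OF this] show "sf_L (surf_rev f g) n u = - (\<sigma> * \<epsilon> * \<kappa> (u $ 1))"
    by (simp add: sf_L_def deriv_surf_rev u n lorentz_rotational algebra_simps power2_eq_square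
        flip: \<open>_ = \<epsilon>\<close>)
qed (simp_all add: sf_M_def sf_N_def deriv_surf_rev u n lorentz_rotational)

lemma mean_curvature_numerator:
  assumes u: "u \<in> param_strip a b"
    and n: "n u = surf_rev (\<lambda>s. \<sigma> * g' s) (\<lambda>s. \<sigma> * f' s) u"
  shows "ff_E (surf_rev f g) u * sf_N (surf_rev f g) n u
       - 2 * ff_F (surf_rev f g) u * sf_M (surf_rev f g) n u
       + ff_G (surf_rev f g) u * sf_L (surf_rev f g) n u
       = - \<sigma> * \<epsilon> * f (u $ 1) * (g' (u $ 1) + f (u $ 1) * \<kappa> (u $ 1))"
proof -
  have s: "u $ 1 \<in> {a<..<b}" using u by (simp add: strip_iff)
  have "ff_E (surf_rev f g) u = \<epsilon>"
    using unit[OF s] by (simp add: ff_E_def deriv_surf_rev u lorentz_rotational power2_eq_square)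
  then show ?thesis unfolding second_form[of u n \<sigma>, OF assms]
    by (simp add: ff_G_def deriv_surf_rev u lorentz_rotational algebra_simps)
qed

end

section \<open>The Laplace operator of the third fundamental form\<close>

locale oriented_profile = profile +
  fixes n :: "real^2 \<Rightarrow> real^3" and \<sigma> :: real
  assumes \<sigma>_sq: "\<sigma> * \<sigma> = 1"
    and normal: "u \<in> param_strip a b \<Longrightarrow> n u = surf_rev (\<lambda>s. \<sigma> * g' s) (\<lambda>s. \<sigma> * f' s) u"
begin

lemma zero_mean_curvature_iff:
  "zero_mean_curvature_on (param_strip a b) (surf_rev f g) n \<longleftrightarrow> (\<forall>s\<in>{a<..<b}. radii_sum s = 0)"
proof -
  have r: "g' s + f s * \<kappa> s = 0 \<longleftrightarrow> radii_sum s = 0" if "s \<in> {a<..<b}" for s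
  proof -
    have "radii_sum s = (g' s + f s * \<kappa> s) / (\<kappa> s * g' s)"
      using g'_nz[OF that] \<kappa>_nz[OF that] by (simp add: radii_sum_def add_divide_distrib)
    then show ?thesis using g'_nz[OF that] \<kappa>_nz[OF that] by simp
  qed
  have \<sigma>: "\<sigma> \<noteq> 0" using \<sigma>_sq by auto
  have "zero_mean_curvature_on (param_strip a b) (surf_rev f g) n
    \<longleftrightarrow> (\<forall>u\<in>param_strip a b. radii_sum (u $ 1) = 0)"
    unfolding zero_mean_curvature_on_def
    by (intro ball_cong refl)
       (use f_nz eps_nz \<sigma> in \<open>simp add: mean_curvature_numerator[of _ n \<sigma>, OF _ normal] r strip_iff\<close>)
  also have "\<dots> \<longleftrightarrow> (\<forall>s\<in>{a<..<b}. radii_sum s = 0)"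
  proof safe
    fix s assume *: "\<forall>u\<in>param_strip a b. radii_sum (u $ 1) = 0" and "s \<in> {a<..<b}"
    then show "radii_sum s = 0" using bspec[OF *, of "vector [s, 0]"] by (simp add: strip_iff)
  qed (simp add: strip_iff)
  finally show ?thesis .
qed

lemma third_form_eq:
  assumes u: "u \<in> param_strip a b"
  shows "third_form n u = diag2 (\<epsilon> * (\<kappa> (u $ 1))\<^sup>2) ((g' (u $ 1))\<^sup>2)"
proof -
  have s: "u $ 1 \<in> {a<..<b}" using u by (simp add: strip_iff)
  have n1: "pdv n 1 u = surf_rev (\<lambda>s. \<sigma> * (\<kappa> s * f' s)) (\<lambda>s. \<sigma> * (\<kappa> s * g' s)) u"
    by (intro pdv_surf_rev(1)[OF u normal] DERIV_cmult deriv_f' deriv_g' s)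
  have n2: "pdv n 2 u = parallel_field (\<lambda>s. \<sigma> * g' s) u"
    by (rule pdv_surf_rev(2)[OF u normal])
  have \<sigma>: "\<sigma> * (\<sigma> * x) = x" for x using \<sigma>_sq by (simp add: mult.assoc[symmetric])
  show ?thesis unfolding unit[OF s, symmetric]
    by (simp add: third_form_def vec_eq_iff forall_2 diag2_nth n1 n2 lorentz_rotational)
       (simp add: \<sigma> \<sigma>_sq algebra_simps power2_eq_square)
qed

text \<open>The area element of the third form is \<open>\<bar>\<kappa> g'\<bar>\<close>. Its sign \<open>\<eta>\<close> is constant, so that the absolute
  value can be differentiated; \<open>\<eta>\<close> then cancels from the Laplacian.\<close>

lemma abs_curvature_product:
  obtains \<eta> where "\<eta> * \<eta> = (1 :: real)"
    "\<And>s. s \<in> {a<..<b} \<Longrightarrow> \<bar>\<kappa> s * g' s\<bar> = \<eta> * (\<kappa> s * g' s)"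
proof -
  have "continuous_on {a<..<b} \<kappa>" "continuous_on {a<..<b} g'"
    by (rule continuous_on_if_deriv[OF deriv_\<kappa>] continuous_on_if_deriv[OF deriv_g'], assumption)+
  then have "continuous_on {a<..<b} (\<lambda>s. sgn (\<kappa> s * g' s))"
    using g'_nz \<kappa>_nz by (intro continuous_on_sgn continuous_intros) auto
  moreover have "finite ((\<lambda>s. sgn (\<kappa> s * g' s)) ` {a<..<b})"
    by (rule finite_subset[of _ "{-1, 0, 1}"]) (auto simp: sgn_if)
  ultimately have "(\<lambda>s. sgn (\<kappa> s * g' s)) constant_on {a<..<b}"
    by (intro continuous_finite_range_constant) auto
  then obtain \<eta> where \<eta>: "\<And>s. s \<in> {a<..<b} \<Longrightarrow> sgn (\<kappa> s * g' s) = \<eta>"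
    unfolding constant_on_def by blast
  obtain s where s: "s \<in> {a<..<b}" using ab dense by auto
  show ?thesis
  proof
    show "\<eta> * \<eta> = 1" using \<eta>[OF s] g'_nz[OF s] \<kappa>_nz[OF s] by (auto simp: sgn_if split: if_splits)
    show "\<bar>\<kappa> s * g' s\<bar> = \<eta> * (\<kappa> s * g' s)" if "s \<in> {a<..<b}" for s
      unfolding \<eta>[OF that, symmetric] by (simp add: abs_sgn mult.commute)
  qed
qed

text \<open>The third form is diagonal with coefficients that depend on \<open>s\<close> alone, so the operator separates
  variables. The coordinate functions of the surface are products \<open>q(s) T(\<theta>)\<close>.\<close>

lemma laplace_III_product:
  fixes p :: "real^2 \<Rightarrow> real"
  assumes u: "u \<in> param_strip a b"
    and p: "\<And>v. v \<in> param_strip a b \<Longrightarrow> p v = q (v $ 1) * T (v $ 2)"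
    and q: "\<And>s. s \<in> {a<..<b} \<Longrightarrow> (q has_real_derivative q' s) (at s)"
      "(q' has_real_derivative q'') (at (u $ 1))"
    and T: "\<And>\<theta>. (T has_real_derivative T' \<theta>) (at \<theta>)"
      "(T' has_real_derivative T'') (at (u $ 2))"
    and s: "s = u $ 1"
  shows "laplace_III n p u
    = - (\<epsilon> / (\<kappa> s * g' s)) * (f' s * q' s + g' s * q'' / \<kappa> s - g' s * q' s * \<kappa>' s / (\<kappa> s)\<^sup>2) * T (u $ 2)
      - q s / (g' s)\<^sup>2 * T''"
proof -
  obtain \<eta> where \<eta>: "\<eta> * \<eta> = (1 :: real)"
    "\<And>s. s \<in> {a<..<b} \<Longrightarrow> \<bar>\<kappa> s * g' s\<bar> = \<eta> * (\<kappa> s * g' s)"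
    using abs_curvature_product by blast
  have sI: "s \<in> {a<..<b}" using u s by (simp add: strip_iff)
  have nz: "\<kappa> s \<noteq> 0" "g' s \<noteq> 0" "\<eta> \<noteq> 0" using \<kappa>_nz g'_nz sI \<eta>(1) by auto
  have vol: "sqrt \<bar>det (third_form n v)\<bar> = \<eta> * (\<kappa> (v $ 1) * g' (v $ 1))"
    if v: "v \<in> param_strip a b" for v
  proof -
    have "\<bar>det (third_form n v)\<bar> = (\<kappa> (v $ 1) * g' (v $ 1))\<^sup>2"
      unfolding third_form_eq[OF v] det_diag2 using eps by (auto simp: abs_mult power_mult_distrib)
    then show ?thesis using \<eta>(2) v by (simp add: strip_iff)
  qed
  have inv: "matrix_inv (third_form n v) = diag2 (1 / (\<epsilon> * (\<kappa> (v $ 1))\<^sup>2)) (1 / (g' (v $ 1))\<^sup>2)"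
    if v: "v \<in> param_strip a b" for v
    unfolding third_form_eq[OF v] using \<kappa>_nz g'_nz eps_nz v
    by (intro matrix_inv_diag2) (auto simp: strip_iff)
  have p1: "pdv p 1 v = q' (v $ 1) * T (v $ 2)" and p2: "pdv p 2 v = q (v $ 1) * T' (v $ 2)"
    if v: "v \<in> param_strip a b" for v
    using pdv_product(1)[OF v p q(1)] pdv_product(2)[OF v p T(1)] v by (auto simp: strip_iff)
  let ?F = "\<lambda>k m v. sqrt \<bar>det (third_form n v)\<bar> * matrix_inv (third_form n v) $ k $ m * pdv p k v"
  have 12: "pdv (?F 1 2) 2 u = 0"
    using pdv_product(2)[OF u, of "?F 1 2" "\<lambda>_. 0" "\<lambda>_. 0" 0] by (simp add: inv diag2_nth)
  have 21: "pdv (?F 2 1) 1 u = 0"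
    using pdv_product(1)[OF u, of "?F 2 1" "\<lambda>_. 0" "\<lambda>_. 0" 0] by (simp add: inv diag2_nth)
  have 22: "pdv (?F 2 2) 2 u = \<eta> * \<kappa> s / g' s * q s * T''"
    unfolding s
  proof (rule pdv_product(2)[OF u _ T(2)])
    fix v assume v: "v \<in> param_strip a b"
    then show "?F 2 2 v = \<eta> * \<kappa> (v $ 1) / g' (v $ 1) * q (v $ 1) * T' (v $ 2)"
      using g'_nz by (simp add: vol inv p2 diag2_nth strip_iff power2_eq_square)
  qed
  have 11: "pdv (?F 1 1) 1 u
     = (\<eta> * \<epsilon> * (f' s * q' s + g' s * q'' / \<kappa> s - g' s * q' s * \<kappa>' s / (\<kappa> s)\<^sup>2)) * T (u $ 2)"
  proof (rule pdv_product(1)[OF u])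
    fix v assume v: "v \<in> param_strip a b"
    then have "1 / \<epsilon> = \<epsilon>" "\<kappa> (v $ 1) \<noteq> 0" using eps \<kappa>_nz by (auto simp: strip_iff)
    then show "?F 1 1 v = (\<lambda>s. \<eta> * \<epsilon> * (g' s * q' s / \<kappa> s)) (v $ 1) * T (v $ 2)"
      using v eps by (auto simp: vol inv p1 diag2_nth power2_eq_square)
  next
    have "((\<lambda>s. g' s * q' s / \<kappa> s) has_real_derivative
        f' s * q' s + g' s * q'' / \<kappa> s - g' s * q' s * \<kappa>' s / (\<kappa> s)\<^sup>2) (at s)"
      using nz by (auto intro!: derivative_eq_intros deriv_g' deriv_\<kappa> sI q(2)[folded s]
          simp: field_simps power2_eq_square)
    then show "((\<lambda>s. \<eta> * \<epsilon> * (g' s * q' s / \<kappa> s)) has_real_derivative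
        \<eta> * \<epsilon> * (f' s * q' s + g' s * q'' / \<kappa> s - g' s * q' s * \<kappa>' s / (\<kappa> s)\<^sup>2)) (at (u $ 1))"
      unfolding s by (rule DERIV_cmult)
  qed
  have "laplace_III n p u = - (1 / (\<eta> * (\<kappa> s * g' s))) *
    (\<eta> * \<epsilon> * (f' s * q' s + g' s * q'' / \<kappa> s - g' s * q' s * \<kappa>' s / (\<kappa> s)\<^sup>2) * T (u $ 2)
      + \<eta> * \<kappa> s / g' s * q s * T'')"
    unfolding laplace_III_def sum_2 11 12 21 22 vol[OF u] s by simp
  also have "\<dots> = - (\<epsilon> / (\<kappa> s * g' s)) * (f' s * q' s + g' s * q'' / \<kappa> s - g' s * q' s * \<kappa>' s / (\<kappa> s)\<^sup>2) * T (u $ 2)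
      - q s / (g' s)\<^sup>2 * T''"
    using nz by (simp add: distrib_left power2_eq_square)
  finally show ?thesis .
qed

lemma laplace_III_surf_rev:
  assumes u: "u \<in> param_strip a b"
  shows "laplace_III_vec n (surf_rev f g) u = surf_rev radial axial u"
proof -
  define s where "s = u $ 1"
  have sI: "s \<in> {a<..<b}" using u by (simp add: strip_iff s_def)
  note nz = g'_nz[OF sI] \<kappa>_nz[OF sI]
  note L = laplace_III_product[OF u _ _ _ _ _ s_def]
  have sin: "(sin has_real_derivative cos \<theta>) (at \<theta>)"
    and cos: "(cos has_real_derivative - sin \<theta>) (at \<theta>)"
    and sin2: "((\<lambda>\<theta>. - sin \<theta>) has_real_derivative - cos \<theta>) (at \<theta>)"
    and one: "((\<lambda>_. 1) has_real_derivative 0) (at \<theta>)" "((\<lambda>_. 0) has_real_derivative 0) (at \<theta>)"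
    for \<theta> :: real
    by (auto intro!: derivative_eq_intros)
  have "(f' has_real_derivative \<kappa> s * g' s) (at (u $ 1))"
    "(g' has_real_derivative \<kappa> s * f' s) (at (u $ 1))"
    using deriv_f'[OF sI] deriv_g'[OF sI] by (simp_all add: s_def)
  note d = deriv_f deriv_g this
  have R: "- (\<epsilon> / (\<kappa> s * g' s)) * (f' s * f' s + g' s * (\<kappa> s * g' s) / \<kappa> s - g' s * f' s * \<kappa>' s / (\<kappa> s)\<^sup>2) * x
      - f s / (g' s)\<^sup>2 * - x = radial s * x" for x
    unfolding radial_def using nz by (simp add: field_simps power2_eq_square power3_eq_cube)
  have A: "- (\<epsilon> / (\<kappa> s * g' s)) * (f' s * g' s + g' s * (\<kappa> s * f' s) / \<kappa> s - g' s * g' s * \<kappa>' s / (\<kappa> s)\<^sup>2) * 1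
      - g s / (g' s)\<^sup>2 * 0 = axial s"
    unfolding axial_def using nz by (simp add: field_simps power2_eq_square power3_eq_cube)
  have "laplace_III n (\<lambda>v. surf_rev f g v $ 1) u = radial s * cos (u $ 2)"
    unfolding R[symmetric]
    by (rule L[where q = f and T = cos and q' = f', OF _ d(1,3) cos sin2]) (auto simp: surf_rev_def s_def)
  moreover have "laplace_III n (\<lambda>v. surf_rev f g v $ 2) u = radial s * sin (u $ 2)"
    unfolding R[symmetric]
    by (rule L[where q = f and T = sin and q' = f', OF _ d(1,3) sin cos]) (auto simp: surf_rev_def s_def)
  moreover have "laplace_III n (\<lambda>v. surf_rev f g v $ 3) u = axial s"
    unfolding A[symmetric]
    by (rule L[where q = g and T = "\<lambda>_. 1" and q' = g', OF _ d(2,4) one]) (auto simp: surf_rev_def s_def)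
  ultimately show ?thesis
    by (simp add: laplace_III_vec_def vec_eq_iff forall_3) (simp add: surf_rev_def s_def)
qed

text \<open>The Laplacian and the position vector have the same angular dependence. Comparing \<open>\<theta> = 0\<close> with
  the opposite meridian \<open>\<theta> = \<pi>\<close> separates the horizontal from the axial part and leaves two
  entries of \<open>A\<close>.\<close>

lemma linear_iff_eigenprofile:
  "(\<exists>A :: real^3^3. \<forall>u\<in>param_strip a b. laplace_III_vec n (surf_rev f g) u = A *v surf_rev f g u)
   \<longleftrightarrow> (\<exists>\<alpha> \<beta>. eigenprofile a b \<epsilon> f g f' g' \<kappa> \<kappa>' \<alpha> \<beta>)"
proof
  assume "\<exists>A :: real^3^3. \<forall>u\<in>param_strip a b. laplace_III_vec n (surf_rev f g) u = A *v surf_rev f g u"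
  then obtain A :: "real^3^3" where
    A: "\<And>u. u \<in> param_strip a b \<Longrightarrow> surf_rev radial axial u = A *v surf_rev f g u"
    by (auto simp: laplace_III_surf_rev)
  have "radial s = A $ 1 $ 1 * f s \<and> axial s = A $ 3 $ 3 * g s" if s: "s \<in> {a<..<b}" for s
    using A[of "vector [s, 0]"] A[of "vector [s, pi]"] s f_nz[OF s]
    by (simp add: strip_iff vec_eq_iff forall_3 matrix_vector_mult_def sum_3 surf_rev_def)
  then have "eigenprofile a b \<epsilon> f g f' g' \<kappa> \<kappa>' (A $ 1 $ 1) (A $ 3 $ 3)"
    by unfold_locales auto
  then show "\<exists>\<alpha> \<beta>. eigenprofile a b \<epsilon> f g f' g' \<kappa> \<kappa>' \<alpha> \<beta>" by blast
next
  assume "\<exists>\<alpha> \<beta>. eigenprofile a b \<epsilon> f g f' g' \<kappa> \<kappa>' \<alpha> \<beta>"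
  then obtain \<alpha> \<beta> where "eigenprofile a b \<epsilon> f g f' g' \<kappa> \<kappa>' \<alpha> \<beta>" by blast
  then interpret eigenprofile a b \<epsilon> f g f' g' \<kappa> \<kappa>' \<alpha> \<beta> .
  let ?A = "\<chi> i j. if i = j then (if i = 3 then \<beta> else \<alpha>) else 0 :: real^3^3"
  have "surf_rev radial axial u = ?A *v surf_rev f g u" if "u \<in> param_strip a b" for u
    using that radial_eq axial_eq
    by (simp add: strip_iff vec_eq_iff forall_3 matrix_vector_mult_def sum_3 surf_rev_def)
  then show "\<exists>A :: real^3^3. \<forall>u\<in>param_strip a b. laplace_III_vec n (surf_rev f g) u = A *v surf_rev f g u"
    by (auto simp: laplace_III_surf_rev)
qed

end

section \<open>Pseudospheres\<close>

context profile
begin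

text \<open>On the quadric, the height \<open>z = g(s)\<close> determines \<open>f(s)\<^sup>2\<close>, and the rotation angle does the rest:
  the surface is the part of the quadric whose heights lie in the range of \<open>g\<close>. That range is open, as
  \<open>g\<close> is continuous and injective.\<close>

lemma openin_quadric_iff:
  "openin (top_of_set {v. (v $ 1)\<^sup>2 + (v $ 2)\<^sup>2 - (v $ 3)\<^sup>2 = k}) (surf_rev f g ` param_strip a b)
   \<longleftrightarrow> (\<forall>s\<in>{a<..<b}. (f s)\<^sup>2 - (g s)\<^sup>2 = k)" (is "openin (top_of_set ?Q) ?M \<longleftrightarrow> ?R")
proof
  have quad: "(surf_rev f g u $ 1)\<^sup>2 + (surf_rev f g u $ 2)\<^sup>2 - (surf_rev f g u $ 3)\<^sup>2
      = (f (u $ 1))\<^sup>2 - (g (u $ 1))\<^sup>2" for u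
    using lorentz_rotational(1)[of f g u f g] by (simp add: lorentz_def power2_eq_square)
  {
    assume "openin (top_of_set ?Q) ?M"
    then have sub: "?M \<subseteq> ?Q" by (rule openin_imp_subset)
    show ?R
    proof
      fix s assume "s \<in> {a<..<b}"
      then have "surf_rev f g (vector [s, 0]) \<in> ?Q"
        by (intro subsetD[OF sub] imageI) (simp add: strip_iff)
      then show "(f s)\<^sup>2 - (g s)\<^sup>2 = k" by (simp add: quad)
    qed
  next
    assume R: ?R
    have "?M = ?Q \<inter> (\<lambda>v. v $ 3) -` (g ` {a<..<b})"
    proof (intro subset_antisym subsetI)
      fix v assume "v \<in> ?M"
      then show "v \<in> ?Q \<inter> (\<lambda>v. v $ 3) -` (g ` {a<..<b})"
        using R by (auto simp: quad strip_iff) (auto simp: surf_rev_def)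
    next
      fix v assume "v \<in> ?Q \<inter> (\<lambda>v. v $ 3) -` (g ` {a<..<b})"
      then obtain s where s: "s \<in> {a<..<b}" "v $ 3 = g s"
        and v: "(v $ 1)\<^sup>2 + (v $ 2)\<^sup>2 - (v $ 3)\<^sup>2 = k" by auto
      have "(v $ 1)\<^sup>2 + (v $ 2)\<^sup>2 = (f s)\<^sup>2" using bspec[OF R s(1)] s(2) v by simp
      then have "(v $ 1 / f s)\<^sup>2 + (v $ 2 / f s)\<^sup>2 = 1"
        using f_nz[OF s(1)] by (simp add: power_divide add_divide_distrib[symmetric])
      then obtain \<theta> where "v $ 1 / f s = cos \<theta>" "v $ 2 / f s = sin \<theta>"
        by (rule sincos_total_2pi)
      then have "v = surf_rev f g (vector [s, \<theta>])"
        using f_nz[OF s(1)] s(2) by (simp add: vec_eq_iff forall_3 surf_rev_def field_simps)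
      then show "v \<in> ?M" using s(1) by (auto simp: strip_iff)
    qed
    moreover have "open (g ` {a<..<b})"
    proof -
      have "continuous_on {a<..<b} g" by (rule continuous_on_if_deriv[OF deriv_g])
      from injective_eq_1d_open_map_UNIV[OF this] inj_g show ?thesis
        by (auto simp: is_interval_oo)
    qed
    then have "open ((\<lambda>v :: real^3. v $ 3) -` (g ` {a<..<b}))"
      by (rule open_vimage) (intro continuous_intros)
    ultimately show "openin (top_of_set ?Q) ?M" by (auto intro: openin_open_Int)
  }
qed

lemma pseudosphere_iff:
  "(\<exists>c>0. open_part_of (surf_rev f g ` param_strip a b) (pseudosphere_real c) \<or>
          open_part_of (surf_rev f g ` param_strip a b) (pseudosphere_imaginary c))
   \<longleftrightarrow> (\<exists>k. k \<noteq> 0 \<and> (\<forall>s\<in>{a<..<b}. (f s)\<^sup>2 - (g s)\<^sup>2 = k))"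
  unfolding open_part_of_def pseudosphere_real_def pseudosphere_imaginary_def openin_quadric_iff
proof
  assume "\<exists>k. k \<noteq> 0 \<and> (\<forall>s\<in>{a<..<b}. (f s)\<^sup>2 - (g s)\<^sup>2 = k)"
  then obtain k where k: "k \<noteq> 0" "\<forall>s\<in>{a<..<b}. (f s)\<^sup>2 - (g s)\<^sup>2 = k" by blast
  have "k = (sqrt \<bar>k\<bar>)\<^sup>2 \<or> k = - (sqrt \<bar>k\<bar>)\<^sup>2" by auto
  then show "\<exists>c>0. (\<forall>s\<in>{a<..<b}. (f s)\<^sup>2 - (g s)\<^sup>2 = c\<^sup>2) \<or> (\<forall>s\<in>{a<..<b}. (f s)\<^sup>2 - (g s)\<^sup>2 = - c\<^sup>2)"
    using k by (intro exI[of _ "sqrt \<bar>k\<bar>"]) (metis real_sqrt_gt_zero zero_less_abs_iff)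
next
  assume "\<exists>c>0. (\<forall>s\<in>{a<..<b}. (f s)\<^sup>2 - (g s)\<^sup>2 = c\<^sup>2) \<or> (\<forall>s\<in>{a<..<b}. (f s)\<^sup>2 - (g s)\<^sup>2 = - c\<^sup>2)"
  then obtain c where "c > 0"
    "(\<forall>s\<in>{a<..<b}. (f s)\<^sup>2 - (g s)\<^sup>2 = c\<^sup>2) \<or> (\<forall>s\<in>{a<..<b}. (f s)\<^sup>2 - (g s)\<^sup>2 = - c\<^sup>2)" by blast
  then show "\<exists>k. k \<noteq> 0 \<and> (\<forall>s\<in>{a<..<b}. (f s)\<^sup>2 - (g s)\<^sup>2 = k)"
    by (metis less_irrefl neg_equal_0_iff_equal zero_eq_power2)
qed

end

section \<open>The classification\<close>

lemma smooth_on_derivs: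
  assumes "smooth_on S f" "s \<in> S"
  shows "(f has_real_derivative deriv f s) (at s)"
    and "(deriv f has_real_derivative deriv (deriv f) s) (at s)"
    and "(deriv (deriv f) has_real_derivative deriv (deriv (deriv f)) s) (at s)"
proof -
  have d: "((deriv ^^ k) f) differentiable (at s)" for k
    using assms by (simp add: smooth_on_def)
  show "(f has_real_derivative deriv f s) (at s)"
    "(deriv f has_real_derivative deriv (deriv f) s) (at s)"
    "(deriv (deriv f) has_real_derivative deriv (deriv (deriv f)) s) (at s)"
    using d[of 0] d[of 1] d[of 2]
    by (simp_all add: DERIV_deriv_iff_real_differentiable numeral_2_eq_2)
qed

lemma unit_speed_profile_if_smooth:
  fixes f g :: "real \<Rightarrow> real"
  assumes ab: "a < b" and f: "smooth_on {a<..<b} f" and g: "smooth_on {a<..<b} g"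
    and nz: "\<forall>s\<in>{a<..<b}. f s \<noteq> 0" and eps: "\<epsilon> = 1 \<or> \<epsilon> = -1"
    and unit: "\<forall>s\<in>{a<..<b}. (deriv f s)\<^sup>2 - (deriv g s)\<^sup>2 = \<epsilon>"
  obtains \<kappa> \<kappa>' where "unit_speed_profile a b \<epsilon> f g (deriv f) (deriv g) \<kappa> \<kappa>'"
proof -
  note df = smooth_on_derivs[OF f] and dg = smooth_on_derivs[OF g]
  \<comment> \<open>Solving \<open>(f'', g'') = \<kappa> (g', f')\<close> with \<open>f'\<^sup>2 - g'\<^sup>2 = \<epsilon>\<close> gives \<open>\<kappa>\<close> without a division.\<close>
  define \<kappa> where "\<kappa> s = \<epsilon> * (deriv (deriv g) s * deriv f s - deriv (deriv f) s * deriv g s)" for s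
  define \<kappa>' where
    "\<kappa>' s = \<epsilon> * (deriv (deriv (deriv g)) s * deriv f s - deriv (deriv (deriv f)) s * deriv g s)" for s
  have orth: "deriv f s * deriv (deriv f) s = deriv g s * deriv (deriv g) s"
    if s: "s \<in> {a<..<b}" for s
  proof -
    have "2 * (deriv f s * deriv (deriv f) s) - 2 * (deriv g s * deriv (deriv g) s) = 0"
      by (rule deriv_eq_if_eq_on_interval[of a b "\<lambda>r. (deriv f r)\<^sup>2 - (deriv g r)\<^sup>2" "\<lambda>_. \<epsilon>", OF _ s])
         (use unit in \<open>auto intro!: derivative_eq_intros df dg s\<close>)
    then show ?thesis by simp
  qed
  have f2: "deriv (deriv f) s = \<kappa> s * deriv g s" and g2: "deriv (deriv g) s = \<kappa> s * deriv f s"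
    if s: "s \<in> {a<..<b}" for s
    using orth[OF s] bspec[OF unit s] eps unfolding \<kappa>_def by algebra+
  have "unit_speed_profile a b \<epsilon> f g (deriv f) (deriv g) \<kappa> \<kappa>'"
  proof
    fix s assume s: "s \<in> {a<..<b}"
    show "(deriv f has_real_derivative \<kappa> s * deriv g s) (at s)"
      "(deriv g has_real_derivative \<kappa> s * deriv f s) (at s)"
      using df(2)[OF s] dg(2)[OF s] by (simp_all add: f2[OF s, symmetric] g2[OF s, symmetric])
    show "(\<kappa> has_real_derivative \<kappa>' s) (at s)" unfolding \<kappa>_def[abs_def] \<kappa>'_def
      by (auto intro!: derivative_eq_intros df dg s simp: algebra_simps)
  qed (use assms df dg in auto)
  then show ?thesis by (rule that)
qed

theorem theorem2:
  fixes f g :: "real \<Rightarrow> real" and a b :: real and n :: "real^2 \<Rightarrow> real^3"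
  assumes "a < b"
    and "smooth_on {a<..<b} f" and "smooth_on {a<..<b} g"
    and "\<forall>s\<in>{a<..<b}. f s \<noteq> 0"
    and "(\<forall>s\<in>{a<..<b}. (deriv f s)\<^sup>2 - (deriv g s)\<^sup>2 = 1) \<or>
         (\<forall>s\<in>{a<..<b}. (deriv f s)\<^sup>2 - (deriv g s)\<^sup>2 = -1)"
    and "nondegenerate_on (param_strip a b) (surf_rev f g)"
    and "unit_normal_field_on (param_strip a b) (surf_rev f g) n"
    and "gauss_curvature_nonvanishing_on (param_strip a b) (surf_rev f g) n"
  shows "(\<exists>A :: real^3^3. \<forall>u\<in>param_strip a b.
            laplace_III_vec n (surf_rev f g) u = A *v surf_rev f g u) \<longleftrightarrow>
         (\<exists>c>0. open_part_of (surf_rev f g ` param_strip a b) (pseudosphere_real c) \<or>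
                 open_part_of (surf_rev f g ` param_strip a b) (pseudosphere_imaginary c)) \<or>
         zero_mean_curvature_on (param_strip a b) (surf_rev f g) n"
proof -
  obtain \<epsilon> :: real where eps: "\<epsilon> = 1 \<or> \<epsilon> = -1"
    and unit: "\<forall>s\<in>{a<..<b}. (deriv f s)\<^sup>2 - (deriv g s)\<^sup>2 = \<epsilon>"
    using assms(5) by blast
  obtain \<kappa> \<kappa>' where "unit_speed_profile a b \<epsilon> f g (deriv f) (deriv g) \<kappa> \<kappa>'"
    using unit_speed_profile_if_smooth[OF assms(1-4) eps unit] .
  then interpret U: unit_speed_profile a b \<epsilon> f g "deriv f" "deriv g" \<kappa> \<kappa>' .
  obtain \<sigma> where \<sigma>: "\<sigma> * \<sigma> = 1" and
    n: "\<And>u. u \<in> param_strip a b \<Longrightarrow> n u = surf_rev (\<lambda>s. \<sigma> * deriv g s) (\<lambda>s. \<sigma> * deriv f s) u"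
    using U.unit_normal_rotational[OF assms(7)] by blast
  have nz: "deriv g s \<noteq> 0 \<and> \<kappa> s \<noteq> 0" if "s \<in> {a<..<b}" for s
  proof -
    have u: "vector [s, 0] \<in> param_strip a b" using that by (simp add: strip_iff)
    have "sf_L (surf_rev f g) n (vector [s, 0]) * sf_N (surf_rev f g) n (vector [s, 0])
        - (sf_M (surf_rev f g) n (vector [s, 0]))\<^sup>2 \<noteq> 0"
      using assms(8) u by (simp add: gauss_curvature_nonvanishing_on_def)
    then show ?thesis unfolding U.second_form[of _ n \<sigma>, OF u n[OF u]] by auto
  qed
  interpret oriented_profile a b \<epsilon> f g "deriv f" "deriv g" \<kappa> \<kappa>' n \<sigma>
    by unfold_locales (use nz \<sigma> n in auto)
  show ?thesis
    unfolding linear_iff_eigenprofile eigenprofile_iff pseudosphere_iff zero_mean_curvature_iff ..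
qed

end
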